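(* Let $q$ be a prime power. If $P$ is a C-shellable $q$-poset, then $P$ is $\mathbb{B}(q)$-positive. In particular, the chain polynomials of $P$ and of its rank-selected subposets $P_S=\{x\in P:\rho(x)\in S\}$, $S\subseteq\mathbb{N}$, are real-rooted.
   Context: $q$-posets: a finite poset $P$ with a least element $\hat0$ is a $q$-poset if for every $x\in P$ the principal order ideal $\langle x\rangle=\{z\in P:z\le x\}$ is isomorphic to the lattice $\mathbb{B}_d(q)$ of all linear subspaces of $\mathbb{F}_q^d$ for some $d$; then $\rho(x)=d$ is the rank of $x$, and the rank $\rho(P)$ is the maximal rank of an element. $\mathbb{B}(q)$-positivity: let $\alpha:\mathbb{R}[t]\to\mathbb{R}[t]$, $\alpha(f)(t)=f(qt)$, let $t$ also denote multiplication by $t$, and put $R^q_{n,k}(t)=(t+\alpha)^{n-k}\,t^k$ for $0\le k\le n$ (so $R^q_{n,0}(t)=\sum_{k}\binom nk_q t^k$, $R^q_{n,n}(t)=t^n$ and $R^q_{n+1,k+1}=R^q_{n+1,k}-q^kR^q_{n,k}$). A $q$-poset $P$ of rank $n$ is $\mathbb{B}(q)$-positive if its rank generating polynomial satisfies $f_P(t)=\sum_{x\in P}t^{\rho(x)}=\sum_{k=0}^n h_k R^q_{n,k}(t)$ with all $h_k\ge0$. C-shellability: a finite poset is pure if all its maximal chains have the same length; facets are maximal elements. Let $P$ be a pure poset with least element $\hat0$. An ordering $x_1,\dots,x_m$ of the facets of $P$ is a C-shelling if $P$ has rank at most one, or the rank of $P$ is at least two and (S1) for each $j>1$, the subposet $H_j=\langle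 x_j\rangle\cap\bigcup_{i<j}\langle x_i\rangle$ of $\langle x_j\rangle$ is pure of rank $\rho(P)-1$; and (S2) for each $j$, $[\hat0,x_j)=\{x\in P:x<x_j\}$ has a C-shelling, and if $j>1$ it has a C-shelling for which the facets of $H_j$ come first. $P$ is C-shellable if it is pure and has a C-shelling. The chain polynomial of a finite poset $Q$ is $c_Q(t)=\sum_C t^{|C|}$, the sum over all chains $C$ in $Q$ (including the empty one). Real-rooted means all complex zeros are real (nonzero constants count as real-rooted). *)

theory Defs
  imports Complex_Main "HOL-Library.Function_Algebras" "HOL-Library.Cardinality"
    "HOL-Computational_Algebra.Polynomial" "HOL-Number_Theory.Prime_Powers"
begin

section \<open>Finite posets\<close>

text \<open>
  A poset is a set \<open>P\<close> of elements of a type of class \<^class>\<open>order\<close>, with the induced order, so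
  that subposets are subsets. Chains and maximal chains are those of \<^locale>\<open>pred_on\<close>; the empty
  set is a chain, and the length of a nonempty chain is its cardinality minus one.
\<close>

definition has_least :: "'a::order set \<Rightarrow> bool" where
  "has_least P \<longleftrightarrow> (\<exists>b\<in>P. \<forall>x\<in>P. b \<le> x)"

definition pideal :: "'a::order set \<Rightarrow> 'a \<Rightarrow> 'a set" where
  "pideal P x = {z\<in>P. z \<le> x}"

definition facets :: "'a::order set \<Rightarrow> 'a set" where
  "facets P = {x\<in>P. \<forall>y\<in>P. \<not> x < y}"

definition order_isomorphic :: "'a::order set \<Rightarrow> 'b::order set \<Rightarrow> bool" where
  "order_isomorphic A B \<longleftrightarrow>
     (\<exists>f. bij_betw f A B \<and> (\<forall>x\<in>A. \<forall>y\<in>A. x \<le> y \<longleftrightarrow> f x \<le> f y))"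

definition pure_poset :: "'a::order set \<Rightarrow> bool" where
  "pure_poset P \<longleftrightarrow>
     (\<forall>C D. pred_on.maxchain P (\<le>) C \<longrightarrow> pred_on.maxchain P (\<le>) D \<longrightarrow> card C = card D)"

text \<open>For a pure poset this is the common length of all maximal chains.\<close>

definition poset_rank :: "'a::order set \<Rightarrow> nat" where
  "poset_rank P = Max {card C - 1 | C. pred_on.chain P (\<le>) C}"

definition chain_poly :: "'a::order set \<Rightarrow> real poly" where
  "chain_poly Q = (\<Sum>C | pred_on.chain Q (\<le>) C. monom 1 (card C))"

text \<open>The zero polynomial is not real-rooted under this definition; nonzero constants are.\<close>

definition real_rooted :: "real poly \<Rightarrow> bool" where
  "real_rooted p \<longleftrightarrow> (\<forall>z::complex. poly (map_poly complex_of_real p) z = 0 \<longrightarrow> z \<in> \<real>)"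


section \<open>C-shellability\<close>

definition shelling_H :: "'a::order set \<Rightarrow> 'a list \<Rightarrow> nat \<Rightarrow> 'a set" where
  "shelling_H P xs j = pideal P (xs ! j) \<inter> (\<Union>i<j. pideal P (xs ! i))"

text \<open>
  Lists are indexed from zero, so the first facet of the ordering has index \<open>0\<close>. Every recursive
  call is on a proper subset of the finite set \<open>P\<close>, so the least fixed point is the only one.
\<close>

inductive C_shelling :: "'a::order set \<Rightarrow> 'a list \<Rightarrow> bool" where
  rank_le_1:
    "\<lbrakk>finite P; has_least P; pure_poset P; distinct xs; set xs = facets P; poset_rank P \<le> 1\<rbrakk>
      \<Longrightarrow> C_shelling P xs"
| rank_ge_2:
    "\<lbrakk>finite P; has_least P; pure_poset P; distinct xs; set xs = facets P; poset_rank P \<ge> 2;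
      \<forall>j<length xs. 0 < j \<longrightarrow>
        pure_poset (shelling_H P xs j) \<and> poset_rank (shelling_H P xs j) = poset_rank P - 1;
      \<forall>j<length xs.
        (\<exists>ys. C_shelling {x\<in>P. x < xs ! j} ys) \<and>
        (0 < j \<longrightarrow> (\<exists>us vs. C_shelling {x\<in>P. x < xs ! j} (us @ vs) \<and>
                          set us = facets (shelling_H P xs j)))\<rbrakk>
      \<Longrightarrow> C_shelling P xs"

definition C_shellable :: "'a::order set \<Rightarrow> bool" where
  "C_shellable P \<longleftrightarrow> pure_poset P \<and> (\<exists>xs. C_shelling P xs)"


section \<open>Posets of subspaces over a finite field\<close>

text \<open>
  The field with \<open>q\<close> elements is a type \<open>'k\<close> of classes \<^class>\<open>field\<close> and \<^class>\<open>finite\<close> with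
  \<open>CARD('k) = q\<close>. Its \<open>d\<close>-th power consists of the functions \<open>nat \<Rightarrow> 'k\<close> that vanish outside
  \<open>{..<d}\<close>, so that \<open>d\<close> can vary within a formula.
\<close>

definition coord_scale :: "'k::field \<Rightarrow> (nat \<Rightarrow> 'k) \<Rightarrow> nat \<Rightarrow> 'k" where
  "coord_scale c v = (\<lambda>i. c * v i)"

global_interpretation coord: vector_space "coord_scale :: 'k::field \<Rightarrow> _"
  by unfold_locales (auto simp: coord_scale_def fun_eq_iff algebra_simps)

definition coord_space :: "nat \<Rightarrow> (nat \<Rightarrow> 'k::field) set" where
  "coord_space d = {v. \<forall>i\<ge>d. v i = 0}"

definition subspace_lattice :: "'k::{field,finite} itself \<Rightarrow> nat \<Rightarrow> (nat \<Rightarrow> 'k) set set" where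
  "subspace_lattice K d = {U. coord.subspace U \<and> U \<subseteq> coord_space d}"

definition q_poset :: "'k::{field,finite} itself \<Rightarrow> 'a::order set \<Rightarrow> bool" where
  "q_poset K P \<longleftrightarrow> finite P \<and> has_least P \<and>
     (\<forall>x\<in>P. \<exists>d. order_isomorphic (pideal P x) (subspace_lattice K d))"

definition q_rank :: "'k::{field,finite} itself \<Rightarrow> 'a::order set \<Rightarrow> 'a \<Rightarrow> nat" where
  "q_rank K P x = (THE d. order_isomorphic (pideal P x) (subspace_lattice K d))"

definition q_poset_rank :: "'k::{field,finite} itself \<Rightarrow> 'a::order set \<Rightarrow> nat" where
  "q_poset_rank K P = Max (q_rank K P ` P)"

definition rank_gen_poly :: "'k::{field,finite} itself \<Rightarrow> 'a::order set \<Rightarrow> real poly" where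
  "rank_gen_poly K P = (\<Sum>x\<in>P. monom 1 (q_rank K P x))"

definition rank_selected :: "'k::{field,finite} itself \<Rightarrow> 'a::order set \<Rightarrow> nat set \<Rightarrow> 'a set" where
  "rank_selected K P S = {x\<in>P. q_rank K P x \<in> S}"


section \<open>Positivity\<close>

definition alpha :: "nat \<Rightarrow> real poly \<Rightarrow> real poly" where
  "alpha q f = pcompose f [:0, of_nat q:]"

definition R_poly :: "nat \<Rightarrow> nat \<Rightarrow> nat \<Rightarrow> real poly" where
  "R_poly q n k = ((\<lambda>f. [:0, 1:] * f + alpha q f) ^^ (n - k)) (monom 1 k)"

definition Bq_positive :: "'k::{field,finite} itself \<Rightarrow> 'a::order set \<Rightarrow> bool" where
  "Bq_positive K P \<longleftrightarrow>
     (\<exists>h :: nat \<Rightarrow> real. (\<forall>k\<le>q_poset_rank K P. 0 \<le> h k) \<and>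
        rank_gen_poly K P =
          (\<Sum>k\<le>q_poset_rank K P. smult (h k) (R_poly CARD('k) (q_poset_rank K P) k)))"

end

theory Submission
  imports Defs
begin

text \<open>
  Sorting the elements of \<open>P\<close> by the first facet above them writes the rank generating polynomial
  as a sum over the facets \<open>x\<^sub>j\<close> of the polynomials of \<open>\<langle>x\<^sub>j\<rangle> - H\<^sub>j\<close>, and \<open>H\<^sub>j\<close> is generated by
  coatoms of \<open>\<langle>x\<^sub>j\<rangle>\<close>. So positivity reduces to a statement about a space \<open>V\<close> over the finite field:
  for every set \<open>A\<close> of hyperplanes, the subspaces of \<open>V\<close> that lie in no member of \<open>A\<close> have a
  positive rank generating polynomial. This follows by induction on \<open>dim V\<close>, from averaging over
  the hyperplanes outside \<open>A\<close> and from adding hyperplanes to \<open>A\<close> one at a time.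

  For real-rootedness fix \<open>z\<close> in the upper half-plane. Sending \<open>f\<^sub>P\<close> to the value at \<open>z\<close> of the chain
  polynomial of \<open>P\<^sub>S\<close> extends to a linear map, and with \<open>u = z / (1 + z)\<close> the images of
  \<open>R\<^sub>n\<^sub>,\<^sub>0, \<dots>, R\<^sub>n\<^sub>,\<^sub>n\<close> have increasing arguments, spread over an angle of at most \<open>arg u < \<pi>\<close>; this
  is preserved by the recursion for \<open>R\<close>. A nonnegative combination in which the first image occurs
  therefore does not vanish.
\<close>

section \<open>The polynomials \<open>R\<close>\<close>

definition lin_ext :: "(nat \<Rightarrow> 'b::real_vector) \<Rightarrow> real poly \<Rightarrow> 'b" where
  "lin_ext e f = (\<Sum>j\<le>degree f. coeff f j *\<^sub>R e j)"

lemma lin_ext_degree_le: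
  assumes "degree f \<le> N"
  shows "lin_ext e f = (\<Sum>j\<le>N. coeff f j *\<^sub>R e j)"
  unfolding lin_ext_def
  by (rule sum.mono_neutral_left) (use assms in \<open>auto simp: coeff_eq_0\<close>)

lemma lin_ext_0 [simp]: "lin_ext e 0 = 0"
  by (simp add: lin_ext_def)

lemma lin_ext_add: "lin_ext e (f + g) = lin_ext e f + lin_ext e g"
proof -
  let ?N = "max (degree f) (degree g)"
  have "degree (f + g) \<le> ?N" by (rule degree_add_le_max)
  then show ?thesis
    by (simp add: lin_ext_degree_le[of _ ?N] scaleR_add_left sum.distrib)
qed

lemma lin_ext_smult: "lin_ext e (smult c f) = c *\<^sub>R lin_ext e f"
  by (simp add: lin_ext_degree_le[of _ "degree f"] degree_smult_le scaleR_sum_right)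

lemma lin_ext_diff: "lin_ext e (f - g) = lin_ext e f - lin_ext e g"
  using lin_ext_add[of e f "smult (-1) g"] lin_ext_smult[of e "-1" g] by simp

lemma lin_ext_sum: "lin_ext e (\<Sum>i\<in>I. f i) = (\<Sum>i\<in>I. lin_ext e (f i))"
  by (induction I rule: infinite_finite_induct) (auto simp: lin_ext_add)

lemma lin_ext_monom: "lin_ext e (monom c n) = c *\<^sub>R e n"
proof -
  have "lin_ext e (monom c n) = (\<Sum>j\<le>n. (if j = n then c *\<^sub>R e j else 0))"
    unfolding lin_ext_degree_le[OF degree_monom_le] by (rule sum.cong) auto
  then show ?thesis by simp
qed

text \<open>Together with \<open>lin_ext_alpha\<close> this moves a functional past
  \<open>t + \<alpha>\<close>: multiplication by \<open>t\<close> shifts the sequence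
  \<open>e\<close>, and \<open>\<alpha>\<close> rescales its entries.\<close>

lemma lin_ext_pCons_0: "lin_ext e (pCons 0 f) = lin_ext (\<lambda>j. e (Suc j)) f"
proof -
  have "lin_ext e (pCons 0 f) = (\<Sum>j\<le>Suc (degree f). coeff (pCons 0 f) j *\<^sub>R e j)"
    by (rule lin_ext_degree_le) (rule degree_pCons_le)
  then show ?thesis
    by (simp add: sum.atMost_Suc_shift lin_ext_def del: sum.atMost_Suc)
qed

section \<open>The operator \<open>\<alpha>\<close>, diagonal on the monomials\<close>

lemma coeff_alpha: "coeff (alpha q f) j = real q ^ j * coeff f j"
proof (induction f arbitrary: j)
  case 0
  then show ?case by (simp add: alpha_def)
next
  case (pCons a p)
  have "alpha q (pCons a p) = [:a:] + pCons 0 (smult (real q) (alpha q p))"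
    by (simp add: alpha_def pcompose_pCons)
  then show ?case using pCons by (cases j) auto
qed

lemma degree_alpha_le: "degree (alpha q f) \<le> degree f"
  by (rule degree_le) (simp add: coeff_alpha coeff_eq_0)

lemma alpha_add: "alpha q (f + g) = alpha q f + alpha q g"
  by (simp add: poly_eq_iff coeff_alpha algebra_simps)

lemma alpha_smult: "alpha q (smult c f) = smult c (alpha q f)"
  by (simp add: poly_eq_iff coeff_alpha)

lemma alpha_sum: "alpha q (\<Sum>i\<in>I. f i) = (\<Sum>i\<in>I. alpha q (f i))"
  by (simp add: poly_eq_iff coeff_alpha coeff_sum sum_distrib_left)

lemma alpha_monom: "alpha q (monom c n) = monom (real q ^ n * c) n"
  by (simp add: poly_eq_iff coeff_alpha)

lemma lin_ext_alpha: "lin_ext e (alpha q f) = lin_ext (\<lambda>j. real q ^ j *\<^sub>R e j) f"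
  unfolding lin_ext_degree_le[OF degree_alpha_le] lin_ext_def[of _ f]
  by (simp add: coeff_alpha mult.commute)

section \<open>The operator \<open>t + \<alpha>\<close> and recursions for the polynomials R\<close>

definition shift_alpha :: "nat \<Rightarrow> real poly \<Rightarrow> real poly" where
  "shift_alpha q f = pCons 0 f + alpha q f"

lemma R_poly_altdef: "R_poly q n k = (shift_alpha q ^^ (n - k)) (monom 1 k)"
  unfolding R_poly_def shift_alpha_def by simp

lemma R_poly_self: "R_poly q n n = monom 1 n"
  by (simp add: R_poly_altdef)

lemma R_poly_Suc: "k \<le> n \<Longrightarrow> R_poly q (Suc n) k = shift_alpha q (R_poly q n k)"
  by (simp add: R_poly_altdef Suc_diff_le)

lemma shift_alpha_add: "shift_alpha q (f + g) = shift_alpha q f + shift_alpha q g"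
  by (simp add: shift_alpha_def alpha_add)

lemma shift_alpha_smult: "shift_alpha q (smult c f) = smult c (shift_alpha q f)"
  by (simp add: shift_alpha_def alpha_smult smult_add_right)

text \<open>For \<open>n = k\<close> this is \<open>(t + \<alpha>) t^k = t^(k+1) + q^k t^k\<close>;
  applying \<open>t + \<alpha>\<close> to both sides raises \<open>n\<close>.\<close>

lemma R_poly_step:
  assumes "k \<le> n"
  shows "R_poly q (Suc n) k = R_poly q (Suc n) (Suc k) + smult (real q ^ k) (R_poly q n k)"
  using assms
proof (induction n rule: dec_induct)
  case base
  show ?case
    by (simp add: R_poly_self R_poly_Suc shift_alpha_def alpha_monom monom_Suc smult_monom)
next
  case (step n)
  then show ?case
    by (simp add: R_poly_Suc[of _ "Suc n"] shift_alpha_add shift_alpha_smult R_poly_Suc[of k n])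
qed

text \<open>Telescoping \<open>R_poly_step\<close> in \<open>k\<close>. Level \<open>n + 1\<close>
  thus arises from level \<open>n\<close> by weighted tail sums, which is the form that
  \<open>fan_tails\<close> treats.\<close>

lemma R_poly_eq_sum:
  assumes "k \<le> Suc n"
  shows "R_poly q (Suc n) k = monom 1 (Suc n) + (\<Sum>i=k..n. smult (real q ^ i) (R_poly q n i))"
  using assms
proof (induction k rule: inc_induct)
  case base
  then show ?case by (simp add: R_poly_self)
next
  case (step k)
  then show ?case by (simp add: R_poly_step[of k n] sum.atLeast_Suc_atMost[of k n])
qed

lemma degree_R_poly: "k \<le> n \<Longrightarrow> degree (R_poly q n k) \<le> n"
proof (induction n rule: dec_induct)
  case base
  then show ?case by (simp add: R_poly_self degree_monom_le)
next
  case (step n)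
  then show ?case
    by (auto simp: R_poly_Suc shift_alpha_def intro!: degree_add_le
        order_trans[OF degree_pCons_le] order_trans[OF degree_alpha_le])
qed

lemma coeff_R_poly_top: "k \<le> n \<Longrightarrow> coeff (R_poly q n k) n = 1"
proof (induction n rule: dec_induct)
  case base
  then show ?case by (simp add: R_poly_self)
next
  case (step n)
  have "coeff (R_poly q n k) (Suc n) = 0"
    using degree_R_poly[of k n q] step by (intro coeff_eq_0) auto
  then show ?case using step by (simp add: R_poly_Suc shift_alpha_def coeff_alpha)
qed

text \<open>Used to read off \<open>h 0\<close> from a constant coefficient.\<close>

lemma coeff_R_poly_0: "k \<le> n \<Longrightarrow> coeff (R_poly q n k) 0 = (if k = 0 then 1 else 0)"
proof (induction n rule: dec_induct)
  case base
  then show ?case by (simp add: R_poly_self)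
next
  case (step n)
  then show ?case by (simp add: R_poly_Suc shift_alpha_def coeff_alpha)
qed

text \<open>The operator \<open>q^n f - \<alpha> f\<close> multiplies the coefficient of
  \<open>t^j\<close> by \<open>q^n - q^j\<close>, a q-analogue of \<open>n f - t f'\<close>. The
  same factors count the hyperplanes above a subspace, so the identity matches
  \<open>avoid_poly_average\<close>. The induction commutes the operator with
  \<open>t + \<alpha>\<close>, using \<open>\<alpha> (t f) = q t \<alpha> f\<close>.\<close>

lemma R_poly_q_derivative:
  assumes "k \<le> n"
  shows "smult (real q ^ n) (R_poly q n k) - alpha q (R_poly q n k) =
         smult (real q ^ n - real q ^ k) (alpha q (R_poly q (n - 1) k))"
  using assms
proof (induction n rule: dec_induct)
  case base
  then show ?case by (simp add: R_poly_self alpha_monom smult_monom)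
next
  case (step n)
  let ?R = "R_poly q n k" and ?R' = "R_poly q (n - 1) k"
  let ?c = "real q ^ n - real q ^ k"
  \<comment> \<open>For \<open>n = k\<close> the index \<open>n - 1\<close> is out of range, but
    then the factor \<open>?c\<close> is 0.\<close>
  have c: "smult ?c (alpha q (shift_alpha q ?R')) = smult ?c (alpha q ?R)"
  proof (cases "n = k")
    case False
    then have "k \<le> n - 1" "Suc (n - 1) = n" using step by auto
    then show ?thesis using R_poly_Suc[of k "n - 1" q] by simp
  qed simp
  have d: "smult (real q ^ n) ?R - alpha q ?R = smult ?c (alpha q ?R')"
    by (rule step.IH)
  have "smult (real q ^ Suc n) (shift_alpha q ?R) - alpha q (shift_alpha q ?R) =
     smult (real q) (pCons 0 (smult (real q ^ n) ?R - alpha q ?R)) 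
     + alpha q (smult (real q ^ n) ?R - alpha q ?R)
     + smult (real q ^ Suc n - real q ^ n) (alpha q ?R)"
    by (simp add: poly_eq_iff shift_alpha_def coeff_alpha coeff_pCons algebra_simps split: nat.split)
  also have "\<dots> = smult ?c (alpha q (shift_alpha q ?R')) + smult (real q ^ Suc n - real q ^ n) (alpha q ?R)"
    unfolding d
    by (simp add: poly_eq_iff shift_alpha_def coeff_alpha coeff_pCons algebra_simps split: nat.split)
  also have "\<dots> = smult (real q ^ Suc n - real q ^ k) (alpha q ?R)"
    unfolding c by (simp add: poly_eq_iff algebra_simps)
  finally show ?case using step by (simp add: R_poly_Suc)
qed

text \<open>As \<open>q \<ge> 2\<close>, the eigenvalues \<open>q^j\<close> of
  \<open>\<alpha>\<close> are distinct. So the q-derivative determines a polynomial up to a multiple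
  of \<open>t^n\<close>.\<close>

lemma q_derivative_eq_0D:
  assumes "q \<ge> 2" and "smult (real q ^ n) d = alpha q d"
  shows "d = monom (coeff d n) n"
proof (rule poly_eqI)
  fix j
  have "real q ^ n * coeff d j = real q ^ j * coeff d j"
    using arg_cong[OF assms(2), of "\<lambda>p. coeff p j"] by (simp add: coeff_alpha)
  then have "n = j \<or> coeff d j = 0" using assms(1) by auto
  then show "coeff d j = coeff (monom (coeff d n) n) j" by auto
qed

text \<open>\<open>(-1)^j q^(j choose 2)\<close> is the Moebius number of the subspace lattice in
  dimension \<open>j\<close>. It satisfies \<open>e (j+1) = - q^j e j\<close>, which says that its
  linear extension vanishes on the image of \<open>t + \<alpha>\<close>.\<close>

definition sign_seq :: "nat \<Rightarrow> nat \<Rightarrow> real" where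
  "sign_seq q j = (-1) ^ j * real q ^ (\<Sum>i<j. i)"

text \<open>For \<open>k < n\<close> the polynomial lies in the image of
  \<open>t + \<alpha>\<close>. Only \<open>R_{n,n} = t^n\<close> survives the functional.\<close>

lemma lin_ext_sign_seq_R_poly:
  assumes "k < n"
  shows "lin_ext (sign_seq q) (R_poly q n k) = 0"
proof -
  obtain m where n: "n = Suc m" "k \<le> m" using assms by (cases n) auto
  have "lin_ext (sign_seq q) (shift_alpha q f) = 0" for f
    unfolding shift_alpha_def lin_ext_add lin_ext_pCons_0 lin_ext_alpha
    by (simp add: sign_seq_def lin_ext_def sum.distrib[symmetric] power_add)
  then show ?thesis using n by (simp add: R_poly_Suc)
qed

section \<open>Complex numbers in a sector\<close>

text \<open>For nonzero entries and \<open>Im u > 0\<close>: turning counterclockwise from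
  \<open>w k\<close> to a later \<open>w l\<close> takes an angle between 0 and
  \<open>arg u\<close>. Imaginary parts avoid the choice of an argument and admit zero
  entries.\<close>

definition fan :: "complex \<Rightarrow> nat \<Rightarrow> (nat \<Rightarrow> complex) \<Rightarrow> bool" where
  "fan u n w \<longleftrightarrow> (\<forall>k l. k \<le> l \<and> l \<le> n \<longrightarrow>
     0 \<le> Im (w l * cnj (w k)) \<and> 0 \<le> Im (u * w k * cnj (w l)))"

text \<open>Multiply the conjugate of the sum by \<open>u * w 0\<close>. Every summand then has
  nonnegative imaginary part, and the one for \<open>k = 0\<close> has the positive imaginary part
  \<open>h 0 * Im u * |w 0|^2\<close>.\<close>

lemma fan_combination_nonzero:
  assumes "fan u n w" "Im u > 0" "w 0 \<noteq> 0" "\<And>k. k \<le> n \<Longrightarrow> 0 \<le> h k" "h 0 > (0::real)"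
  shows "(\<Sum>k\<le>n. h k *\<^sub>R w k) \<noteq> 0"
proof
  assume "(\<Sum>k\<le>n. h k *\<^sub>R w k) = 0"
  then have "Im (u * w 0 * cnj (\<Sum>k\<le>n. h k *\<^sub>R w k)) = 0" by simp
  then have "(\<Sum>k\<le>n. h k * Im (u * w 0 * cnj (w k))) = 0"
    by (simp add: sum_distrib_left Im_sum algebra_simps sum.distrib sum_subtractf)
  moreover have "\<And>k. k \<le> n \<Longrightarrow> 0 \<le> h k * Im (u * w 0 * cnj (w k))"
    using assms unfolding fan_def by (intro mult_nonneg_nonneg) auto
  ultimately have "h 0 * Im (u * w 0 * cnj (w 0)) = 0"
    by (subst (asm) sum_nonneg_eq_0_iff) auto
  moreover have "u * w 0 * cnj (w 0) = u * of_real ((cmod (w 0))\<^sup>2)"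
    by (simp only: mult.assoc complex_norm_square)
  ultimately show False using assms by auto
qed

lemma fan_mult:
  assumes "fan u n w"
  shows "fan u n (\<lambda>k. c * w k)"
proof -
  have *: "Im (v * (c * w k) * cnj (c * w l)) = (cmod c)\<^sup>2 * Im (v * w k * cnj (w l))" for k l v
  proof -
    have "v * (c * w k) * cnj (c * w l) = of_real ((cmod c)\<^sup>2) * (v * w k * cnj (w l))"
      unfolding complex_norm_square by simp
    then show ?thesis by (simp only: times_complex.sel Re_complex_of_real Im_complex_of_real)
  qed
  show ?thesis
    using assms *[of 1] * unfolding fan_def
    by (simp del: times_complex.sel complex_cnj_mult)
qed

lemma fan_scaleR:
  assumes "fan u n w" "\<And>k. k \<le> n \<Longrightarrow> 0 \<le> h k"
  shows "fan u n (\<lambda>k. h k *\<^sub>R w k)"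
  unfolding fan_def
proof (intro allI impI)
  fix k l assume kl: "k \<le> l \<and> l \<le> n"
  have "Im (v * (h k *\<^sub>R w k) * cnj (h l *\<^sub>R w l)) = h k * h l * Im (v * w k * cnj (w l))" for k l v
    by (simp add: algebra_simps)
  from this[of 1] this kl show "0 \<le> Im (h l *\<^sub>R w l * cnj (h k *\<^sub>R w k)) \<and>
       0 \<le> Im (u * h k *\<^sub>R w k * cnj (h l *\<^sub>R w l))"
    using assms unfolding fan_def by simp
qed

lemma Im_sum_mult_cnj_nonneg:
  assumes "\<And>i j. i \<in> I \<Longrightarrow> j \<in> J \<Longrightarrow> 0 \<le> Im (c * g i * cnj (g j))"
  shows "0 \<le> Im (c * sum g I * cnj (sum g J))"
proof -
  have "c * sum g I * cnj (sum g J) = (\<Sum>i\<in>I. \<Sum>j\<in>J. c * g i * cnj (g j))"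
    by (simp add: sum_distrib_left sum_distrib_right cnj_sum mult.assoc)
       (rule sum.swap)
  then show ?thesis using assms by (simp add: Im_sum sum_nonneg del: times_complex.sel)
qed

text \<open>These are the passages from \<open>n\<close> to \<open>n + 1\<close> in
  \<open>fan_R_poly\<close>: the first when rank \<open>n + 1\<close> is not selected, the second,
  up to a common factor, when it is. The signs come from pairing sums over disjoint blocks of
  indices, and from \<open>Im u > 0\<close> when a block meets itself.\<close>

lemma fan_tails:
  assumes "fan u n g" "Im u > 0"
  shows "fan u (Suc n) (\<lambda>k. \<Sum>i=k..n. g i)"
  and "fan u (Suc n) (\<lambda>k. u * (\<Sum>i<k. g i) + (\<Sum>i=k..n. g i))"
proof -
  have up: "0 \<le> Im (g j * cnj (g i))" and dn: "0 \<le> Im (u * g i * cnj (g j))"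
    if "i \<le> j" "j \<le> n" for i j
    using assms that unfolding fan_def by auto
  have *: "(0 \<le> Im (sum g {l..n} * cnj (sum g {k..n})) \<and>
       0 \<le> Im (u * sum g {k..n} * cnj (sum g {l..n})))
       \<and> (0 \<le> Im ((u * sum g {..<l} + sum g {l..n}) * cnj (u * sum g {..<k} + sum g {k..n})) \<and>
       0 \<le> Im (u * (u * sum g {..<k} + sum g {k..n}) * cnj (u * sum g {..<l} + sum g {l..n})))"
    if "k \<le> l" "l \<le> Suc n" for k l
  proof -
    \<comment> \<open>\<open>A\<close>, \<open>M\<close>, \<open>B\<close> are the sums over the
      consecutive blocks cut out by \<open>k\<close> and \<open>l\<close>; \<open>fan u n g\<close>
      fixes the sign of each pairing of an earlier block with a later one.\<close>
    define A where "A = sum g {..<k}"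
    define M where "M = sum g {k..<l}"
    define B where "B = sum g {l..n}"
    have "{k..n} = {k..<l} \<union> {l..n}" "{..<l} = {..<k} \<union> {k..<l}" using that by auto
    then have eq: "sum g {k..n} = M + B" "sum g {..<l} = A + M"
      by (simp_all add: A_def M_def B_def sum.union_disjoint ivl_disj_int)
    have 1: "0 \<le> Im (B * cnj M)" "0 \<le> Im (M * cnj A)"
      unfolding A_def M_def B_def 
      using that by (auto intro!: Im_sum_mult_cnj_nonneg[where c = 1, simplified] up[simplified])
    have 2: "0 \<le> Im (u * M * cnj B)" "0 \<le> Im (u * A * cnj M)"
      unfolding A_def M_def B_def
      using that by (auto intro!: Im_sum_mult_cnj_nonneg dn simp del: times_complex.sel cnj_sum)
    have sq: "Im (u * X * cnj X) = Im u * (cmod X)\<^sup>2" for X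
      unfolding mult.assoc complex_norm_square[symmetric] by simp
    have e1: "Im (B * cnj (M + B)) = Im (B * cnj M)"
      by (simp add: algebra_simps)
    have e2: "Im (u * (M + B) * cnj B) = Im (u * M * cnj B) + Im u * (cmod B)\<^sup>2"
      unfolding sq[symmetric] by (simp add: algebra_simps)
    \<comment> \<open>In the expansion, the two products of \<open>A\<close> and \<open>B\<close>
      are conjugate to each other, so their imaginary parts cancel. All remaining terms are
      nonnegative.\<close>
    have e3: "Im ((u * (A + M) + B) * cnj (u * A + (M + B))) =
       Im (u * A * cnj M) + (cmod u)\<^sup>2 * Im (M * cnj A) + Im u * (cmod M)\<^sup>2 + Im (u * M * cnj B) + Im (B * cnj M)"
      unfolding cmod_power2 by (simp add: algebra_simps power2_eq_square)
    have e4: "Im (u * (u * A + (M + B)) * cnj (u * (A + M) + B)) =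
       Im u * (cmod (u * A + B))\<^sup>2 + (cmod u)\<^sup>2 * Im (u * A * cnj M) + (cmod u)\<^sup>2 * Im (M * cnj A)
       + Im (u * M * cnj B) + (cmod u)\<^sup>2 * Im (B * cnj M)"
      unfolding cmod_power2 by (simp add: algebra_simps power2_eq_square)
    show ?thesis
      unfolding eq A_def[symmetric] B_def[symmetric] e1 e2 e3 e4
      using 1 2 \<open>Im u > 0\<close> by (simp del: times_complex.sel)
  qed
  show "fan u (Suc n) (\<lambda>k. \<Sum>i=k..n. g i)"
    "fan u (Suc n) (\<lambda>k. u * (\<Sum>i<k. g i) + (\<Sum>i=k..n. g i))"
    unfolding fan_def using * by blast+
qed

section \<open>Subspaces avoiding a set of hyperplanes\<close>

lemma card_field_ge_2: "CARD('k::{field,finite}) \<ge> 2"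
proof -
  have "card {0, 1 :: 'k} \<le> CARD('k)" by (rule card_mono) auto
  then show ?thesis by simp
qed

lemma span_insert_bij_betw:
  fixes v :: "nat \<Rightarrow> 'k::{field,finite}"
  assumes "v \<notin> coord.span S"
  shows "bij_betw (\<lambda>(c, x). x + coord_scale c v) (UNIV \<times> coord.span S) (coord.span (insert v S))"
proof (rule bij_betw_imageI)
  have eq: "c = d" if "x \<in> coord.span S" "y \<in> coord.span S"
    and "x + coord_scale c v = y + coord_scale d v" for x y c d
  proof (rule ccontr)
    assume "c \<noteq> d"
    have "coord_scale (c - d) v = y - x"
      using that(3) by (simp add: coord.scale_left_diff_distrib algebra_simps)
    then have "coord_scale (c - d) v \<in> coord.span S"
      using that by (simp add: coord.span_diff)
    then have "coord_scale (inverse (c - d)) (coord_scale (c - d) v) \<in> coord.span S"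
      by (rule coord.span_scale)
    then show False using \<open>c \<noteq> d\<close> assms by simp
  qed
  show "inj_on (\<lambda>(c, x). x + coord_scale c v) (UNIV \<times> coord.span S)"
  proof (rule inj_onI, clarsimp)
    fix a b c d
    assume *: "b \<in> coord.span S" "d \<in> coord.span S" "b + coord_scale a v = d + coord_scale c v"
    from eq[OF *] * show "a = c \<and> b = d" by simp
  qed
  show "(\<lambda>(c, x). x + coord_scale c v) ` (UNIV \<times> coord.span S) = coord.span (insert v S)"
  proof (intro set_eqI iffI)
    fix x assume "x \<in> coord.span (insert v S)"
    then obtain c where "x - coord_scale c v \<in> coord.span S"
      unfolding coord.span_breakdown_eq by blast
    then show "x \<in> (\<lambda>(c, x). x + coord_scale c v) ` (UNIV \<times> coord.span S)"
      by (intro image_eqI[of _ _ "(c, x - coord_scale c v)"]) auto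
  next
    fix x assume "x \<in> (\<lambda>(c, x). x + coord_scale c v) ` (UNIV \<times> coord.span S)"
    then obtain c y where "y \<in> coord.span S" "x = y + coord_scale c v" by auto
    then show "x \<in> coord.span (insert v S)"
      unfolding coord.span_breakdown_eq by (intro exI[of _ c]) simp
  qed
qed

lemma card_span_insert:
  fixes v :: "nat \<Rightarrow> 'k::{field,finite}"
  assumes "v \<notin> coord.span S"
  shows "card (coord.span (insert v S)) = CARD('k) * card (coord.span S)"
  using bij_betw_same_card[OF span_insert_bij_betw[OF assms]] by (simp add: card_cartesian_product)

lemma finite_span_insert:
  fixes v :: "nat \<Rightarrow> 'k::{field,finite}"
  assumes "finite (coord.span S)"
  shows "finite (coord.span (insert v S))"
proof (cases "v \<in> coord.span S")
  case True
  then show ?thesis using assms by (simp add: coord.span_redundant)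
next
  case False
  then show ?thesis using bij_betw_finite[OF span_insert_bij_betw[OF False]] assms by simp
qed

lemma card_span_independent:
  fixes B :: "(nat \<Rightarrow> 'k::{field,finite}) set"
  assumes "finite B" "coord.independent B"
  shows "card (coord.span B) = CARD('k) ^ card B"
  using assms
proof (induction B)
  case empty
  then show ?case by (simp add: coord.span_empty)
next
  case (insert b B)
  then have "b \<notin> coord.span B" "coord.independent B"
    by (simp_all add: coord.independent_insert)
  then show ?case using insert by (simp add: card_span_insert)
qed

text \<open>The ambient space of all functions is infinite dimensional; dimensions of its finite
  subspaces are compared below through cardinalities, as \<open>q^d\<close> determines
  \<open>d\<close>.\<close>

lemma card_subspace:
  fixes U :: "(nat \<Rightarrow> 'k::{field,finite}) set"
  assumes "coord.subspace U" "finite U"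
  shows "card U = CARD('k) ^ coord.dim U"
proof -
  obtain B where B: "B \<subseteq> U" "coord.independent B" "U \<subseteq> coord.span B" "card B = coord.dim U"
    using coord.basis_exists by blast
  then have "coord.span B = U" using assms(1) by (simp add: coord.span_subspace)
  then show ?thesis using B card_span_independent[of B] finite_subset[OF B(1) assms(2)] by simp
qed

lemma dim_zero_space: "coord.dim {0 :: nat \<Rightarrow> 'k::{field,finite}} = 0"
  using card_subspace[of "{0 :: nat \<Rightarrow> 'k}"] card_field_ge_2[where 'k='k]
  by (cases "coord.dim {0 :: nat \<Rightarrow> 'k}") auto

lemma dim_subspace_le:
  fixes U :: "(nat \<Rightarrow> 'k::{field,finite}) set"
  assumes "coord.subspace U" "coord.subspace V" "U \<subseteq> V" "finite V"
  shows "coord.dim U \<le> coord.dim V"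
proof -
  have "CARD('k) ^ coord.dim U \<le> CARD('k) ^ coord.dim V"
    using assms card_mono[of V U] by (simp add: card_subspace[symmetric] finite_subset)
  then show ?thesis using card_field_ge_2[where 'k='k] by (simp add: power_increasing_iff)
qed

lemma subspace_eq_of_dim_le:
  fixes U :: "(nat \<Rightarrow> 'k::{field,finite}) set"
  assumes "coord.subspace U" "coord.subspace V" "U \<subseteq> V" "finite V" "coord.dim V \<le> coord.dim U"
  shows "U = V"
proof -
  have "coord.dim U = coord.dim V" using dim_subspace_le[OF assms(1-4)] assms(5) by simp
  then have "card U = card V" using assms finite_subset[OF assms(3,4)] by (simp add: card_subspace)
  then show ?thesis using assms by (simp add: card_subset_eq)
qed

lemma dim_span_insert:
  fixes U :: "(nat \<Rightarrow> 'k::{field,finite}) set"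
  assumes "coord.subspace U" "finite U" "v \<notin> U"
  shows "coord.dim (coord.span (insert v U)) = Suc (coord.dim U)"
    and "finite (coord.span (insert v U))"
proof -
  have U: "coord.span U = U" using assms(1) by (simp add: coord.span_eq_iff)
  show fin: "finite (coord.span (insert v U))"
    by (rule finite_span_insert) (simp add: U assms)
  have "card (coord.span (insert v U)) = CARD('k) * card U"
    using card_span_insert[of v U] assms by (simp add: U)
  then have "CARD('k) ^ coord.dim (coord.span (insert v U)) = CARD('k) ^ Suc (coord.dim U)"
    using card_subspace[OF coord.subspace_span fin] card_subspace[OF assms(1,2)] by simp
  then show "coord.dim (coord.span (insert v U)) = Suc (coord.dim U)"
    using card_field_ge_2[where 'k='k] by (subst (asm) power_inject_exp) auto
qed

section \<open>Hyperplanes, and how many of them contain a given subspace\<close>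

definition hyperplanes :: "(nat \<Rightarrow> 'k::{field,finite}) set \<Rightarrow> (nat \<Rightarrow> 'k) set set" where
  "hyperplanes V = {H. coord.subspace H \<and> H \<subseteq> V \<and> Suc (coord.dim H) = coord.dim V}"

lemma finite_hyperplanes: "finite V \<Longrightarrow> finite (hyperplanes V)"
  by (rule finite_subset[of _ "Pow V"]) (auto simp: hyperplanes_def)

text \<open>A vector \<open>v\<close> of \<open>a\<close> outside \<open>p\<close> spans
  \<open>V\<close> together with \<open>p\<close>. Subtracting multiples of \<open>v\<close> shows
  that it spans \<open>a\<close> together with \<open>p \<inter> a\<close>, so the intersection has
  dimension one less than \<open>a\<close>, hence one less than \<open>p\<close>.\<close>

lemma hyperplane_Int:
  fixes V :: "(nat \<Rightarrow> 'k::{field,finite}) set"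
  assumes "finite V" "coord.subspace V" "p \<in> hyperplanes V" "a \<in> hyperplanes V" "p \<noteq> a"
  shows "p \<inter> a \<in> hyperplanes p"
proof -
  have p: "coord.subspace p" "p \<subseteq> V" "Suc (coord.dim p) = coord.dim V" "finite p"
    and a: "coord.subspace a" "a \<subseteq> V" "Suc (coord.dim a) = coord.dim V" "finite a"
    using assms unfolding hyperplanes_def by (auto intro: finite_subset)
  have "\<not> a \<subseteq> p"
    using subspace_eq_of_dim_le[of a p] a p assms(5) by auto
  then obtain v where v: "v \<in> a" "v \<notin> p" by auto
  have sub: "coord.subspace (p \<inter> a)" using a p by (simp add: coord.subspace_inter)
  have "coord.span (insert v p) = V"
  proof (rule subspace_eq_of_dim_le)
    show "coord.span (insert v p) \<subseteq> V"
      using v a p assms(2) by (intro coord.span_minimal) auto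
    show "coord.dim V \<le> coord.dim (coord.span (insert v p))"
      using dim_span_insert(1)[OF p(1,4) v(2)] p by simp
  qed (use assms in auto)
  moreover have "a \<subseteq> coord.span (insert v (p \<inter> a))" if "V = coord.span (insert v p)"
  proof
    fix x assume x: "x \<in> a"
    then have "x \<in> coord.span (insert v p)" using a that by auto
    then obtain c where "x - coord_scale c v \<in> p"
      using p(1) by (auto simp: coord.span_breakdown_eq coord.span_eq_iff[THEN iffD2])
    moreover have "x - coord_scale c v \<in> a"
      using x v a(1) by (simp add: coord.subspace_diff coord.subspace_scale)
    ultimately show "x \<in> coord.span (insert v (p \<inter> a))"
      unfolding coord.span_breakdown_eq by (blast intro: coord.span_base)
  qed
  moreover have "coord.span (insert v (p \<inter> a)) \<subseteq> a"
    using v a by (intro coord.span_minimal) auto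
  ultimately have "coord.span (insert v (p \<inter> a)) = a" by auto
  then have "coord.dim a = Suc (coord.dim (p \<inter> a))"
    using dim_span_insert(1)[OF sub, of v] v p by auto
  then show ?thesis using sub a p unfolding hyperplanes_def by auto
qed

lemma smult_sum_right: "smult c (\<Sum>i\<in>I. f i) = (\<Sum>i\<in>I. smult c (f i))"
  by (induction I rule: infinite_finite_induct) (auto simp: smult_add_right)

lemma sum_card_swap:
  assumes "finite A" "finite B"
  shows "(\<Sum>x\<in>A. card {y\<in>B. R x y}) = (\<Sum>y\<in>B. card {x\<in>A. R x y})"
proof -
  have "(\<Sum>x\<in>A. card {y\<in>B. R x y}) = (\<Sum>x\<in>A. \<Sum>y\<in>B. if R x y then 1 else 0)"
    using assms by (simp add: sum.If_cases Int_def)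
  also have "\<dots> = (\<Sum>y\<in>B. card {x\<in>A. R x y})"
    using assms by (subst sum.swap) (simp add: sum.If_cases Int_def)
  finally show ?thesis .
qed

text \<open>
  Downward induction on \<open>dim U\<close>: counting the pairs \<open>(v, H)\<close> with \<open>v \<in> H - U\<close> relates the
  hyperplanes above \<open>U\<close> to those above the spaces spanned by \<open>U\<close> and one more vector.
\<close>
lemma card_hyperplanes_above:
  fixes V :: "(nat \<Rightarrow> 'k::{field,finite}) set"
  assumes "finite V" "coord.subspace V" "coord.subspace U" "U \<subseteq> V"
  defines "q \<equiv> real CARD('k)"
  shows "real (card {H\<in>hyperplanes V. U \<subseteq> H}) * (q - 1) * q ^ coord.dim U
       = q ^ coord.dim V - q ^ coord.dim U"
  using assms(3,4)
proof (induction "coord.dim V - coord.dim U" arbitrary: U rule: less_induct)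
  case less
  let ?n = "coord.dim V" and ?m = "coord.dim U"
  let ?S = "{H\<in>hyperplanes V. U \<subseteq> H}"
  have q: "q > 1" using card_field_ge_2[where 'k='k] by (simp add: q_def)
  have finU: "finite U" using less.prems assms(1) finite_subset by blast
  have mn: "?m \<le> ?n" using less.prems assms by (intro dim_subspace_le)
  have finS: "finite ?S" using finite_hyperplanes[OF assms(1)] by simp
  \<comment> \<open>In codimension 0 there is no vector outside \<open>U\<close>, and in codimension
    1 the factor \<open>q^n - q^(m+1)\<close> that is cancelled at the end vanishes. Both are
    settled directly.\<close>
  consider "?n = ?m" | "?n = Suc ?m" | "Suc ?m < ?n" using mn by linarith
  then show ?case
  proof cases
    case 1
    have "?S = {}"
    proof (intro equals0I)
      fix H assume "H \<in> ?S"
      then have "coord.dim U \<le> coord.dim H" "Suc (coord.dim H) = ?n"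
        using less.prems finite_subset[of H V] assms(1) by (auto simp: hyperplanes_def intro!: dim_subspace_le)
      then show False using 1 by simp
    qed
    then have "card ?S = 0" by (simp only: card.empty)
    then show ?thesis using 1 by simp
  next
    case 2
    have "?S = {U}"
    proof (intro equalityI subsetI)
      fix H assume "H \<in> ?S"
      then have "U = H"
        using less.prems 2 finite_subset[of H V] assms(1)
        by (intro subspace_eq_of_dim_le) (auto simp: hyperplanes_def)
      then show "H \<in> {U}" by simp
    qed (use less.prems 2 in \<open>auto simp: hyperplanes_def\<close>)
    then have "card ?S = 1" by simp
    then show ?thesis using 2 by (simp add: algebra_simps)
  next
    case 3
    have above: "real (card {H\<in>?S. v \<in> H}) * (q - 1) * q ^ Suc ?m = q ^ ?n - q ^ Suc ?m"
      if v: "v \<in> V - U" for v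
    proof -
      let ?W = "coord.span (insert v U)"
      have dW: "coord.dim ?W = Suc ?m" using dim_span_insert(1)[of U v] less.prems finU v by auto
      have "?W \<subseteq> V" using v less.prems assms(2) by (intro coord.span_minimal) auto
      then have "real (card {H\<in>hyperplanes V. ?W \<subseteq> H}) * (q - 1) * q ^ coord.dim ?W
          = q ^ ?n - q ^ coord.dim ?W"
        using 3 dW by (intro less.hyps) auto
      moreover have "?W \<subseteq> H \<longleftrightarrow> U \<subseteq> H \<and> v \<in> H" if "coord.subspace H" for H
        using coord.span_minimal[OF _ that, of "insert v U"] coord.span_superset[of "insert v U"]
        by blast
      then have "{H\<in>hyperplanes V. ?W \<subseteq> H} = {H\<in>?S. v \<in> H}"
        by (auto simp: hyperplanes_def)
      ultimately show ?thesis using dW by simp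
    qed
    have "real (\<Sum>v\<in>V - U. card {H\<in>?S. v \<in> H}) = real (\<Sum>H\<in>?S. card {v\<in>V - U. v \<in> H})"
      using sum_card_swap[of "V - U" ?S "\<lambda>v H. v \<in> H"] assms(1) finS by simp
    also have "\<dots> = (\<Sum>H\<in>?S. q ^ (?n - 1) - q ^ ?m)"
      unfolding of_nat_sum
    proof (rule sum.cong)
      fix H assume H: "H \<in> ?S"
      then have finH: "finite H" using assms(1) by (auto simp: hyperplanes_def intro: finite_subset)
      have "{v\<in>V - U. v \<in> H} = H - U" using H by (auto simp: hyperplanes_def)
      then have "card {v\<in>V - U. v \<in> H} = card H - card U" using H finU by (simp add: card_Diff_subset)
      moreover have "card H = CARD('k) ^ (?n - 1)"
      proof -
        have "coord.subspace H" "?n - 1 = coord.dim H" using H by (auto simp: hyperplanes_def)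
        then show ?thesis using card_subspace[of H] finH by simp
      qed
      moreover have "card U \<le> card H" using H finH by (intro card_mono) auto
      ultimately show "real (card {v\<in>V - U. v \<in> H}) = q ^ (?n - 1) - q ^ ?m"
        using card_subspace[of U] finU less.prems by (simp add: q_def of_nat_diff)
    qed simp
    finally have eq: "(\<Sum>v\<in>V - U. real (card {H\<in>?S. v \<in> H})) = real (card ?S) * (q ^ (?n - 1) - q ^ ?m)"
      by simp
    have "real (card (V - U)) = q ^ ?n - q ^ ?m"
      using less.prems finU assms card_mono[of V U] card_subspace[of V] card_subspace[of U]
      by (simp add: card_Diff_subset of_nat_diff q_def)
    then have "(q ^ ?n - q ^ ?m) * (q ^ ?n - q ^ Suc ?m)
       = (\<Sum>v\<in>V - U. real (card {H\<in>?S. v \<in> H}) * (q - 1) * q ^ Suc ?m)"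
      using above by simp
    also have "\<dots> = real (card ?S) * (q ^ (?n - 1) - q ^ ?m) * (q - 1) * q ^ Suc ?m"
      unfolding sum_distrib_right[symmetric] eq ..
    also have "\<dots> = (real (card ?S) * (q - 1) * q ^ ?m) * (q ^ ?n - q ^ Suc ?m)"
      using 3 by (cases ?n) (auto simp: algebra_simps)
    finally have eq2: "(q ^ ?n - q ^ ?m) * (q ^ ?n - q ^ Suc ?m) =
        (real (card ?S) * (q - 1) * q ^ ?m) * (q ^ ?n - q ^ Suc ?m)" .
    moreover have "q ^ ?n - q ^ Suc ?m \<noteq> 0"
      using power_strict_increasing[OF 3 q] by linarith
    ultimately show ?thesis unfolding mult.commute[of _ "q ^ ?n - q ^ Suc ?m"] by (simp only: mult_cancel_left) simp
  qed
qed

section \<open>Rank polynomials of the subspaces avoiding a set of hyperplanes\<close>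

definition avoid_poly ::
    "(nat \<Rightarrow> 'k::{field,finite}) set \<Rightarrow> (nat \<Rightarrow> 'k) set set \<Rightarrow> real poly" where
  "avoid_poly V A =
     (\<Sum>U | coord.subspace U \<and> U \<subseteq> V \<and> (\<forall>a\<in>A. \<not> U \<subseteq> a). monom 1 (coord.dim U))"

lemma finite_subspaces: "finite V \<Longrightarrow> finite {U. coord.subspace U \<and> U \<subseteq> V \<and> Q U}"
  by (rule finite_subset[of _ "Pow V"]) auto

text \<open>A subspace of \<open>p\<close> lies in \<open>a\<close> exactly if it lies in the trace
  \<open>p \<inter> a\<close>.\<close>

lemma avoid_poly_hyperplane:
  fixes V :: "(nat \<Rightarrow> 'k::{field,finite}) set"
  assumes "p \<in> hyperplanes V"
  shows "avoid_poly p ((\<inter>) p ` A) =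
     (\<Sum>U | (coord.subspace U \<and> U \<subseteq> V \<and> (\<forall>a\<in>A. \<not> U \<subseteq> a)) \<and> U \<subseteq> p. monom 1 (coord.dim U))"
  unfolding avoid_poly_def using assms
  by (intro sum.cong) (auto simp: hyperplanes_def)

text \<open>Deletion and restriction: the subspaces lost when \<open>p\<close> joins
  \<open>A\<close> are those inside \<open>p\<close>, and they only see the traces of
  \<open>A\<close> on \<open>p\<close>.\<close>

lemma avoid_poly_insert:
  fixes V :: "(nat \<Rightarrow> 'k::{field,finite}) set"
  assumes "finite V" "p \<in> hyperplanes V"
  shows "avoid_poly V A = avoid_poly V (insert p A) + avoid_poly p ((\<inter>) p ` A)"
  unfolding avoid_poly_hyperplane[OF assms(2)] unfolding avoid_poly_def
proof (subst sum.union_disjoint[symmetric])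
  show "finite {U. coord.subspace U \<and> U \<subseteq> V \<and> (\<forall>a\<in>insert p A. \<not> U \<subseteq> a)}"
    by (rule finite_subspaces) fact
  show "finite {U. (coord.subspace U \<and> U \<subseteq> V \<and> (\<forall>a\<in>A. \<not> U \<subseteq> a)) \<and> U \<subseteq> p}"
    by (rule finite_subset[OF _ finite_subspaces[OF assms(1), of "\<lambda>_. True"]]) blast
qed (auto intro!: sum.cong)

lemma hyperplane_restriction:
  fixes V :: "(nat \<Rightarrow> 'k::{field,finite}) set"
  assumes "finite V" "coord.subspace V" "p \<in> hyperplanes V" "A \<subseteq> hyperplanes V" "p \<notin> A"
  shows "finite p" "coord.subspace p" "Suc (coord.dim p) = coord.dim V" "(\<inter>) p ` A \<subseteq> hyperplanes p"
proof -
  show "finite p" "coord.subspace p" "Suc (coord.dim p) = coord.dim V"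
    using assms finite_subset[of p V] by (auto simp: hyperplanes_def)
  show "(\<inter>) p ` A \<subseteq> hyperplanes p"
    using hyperplane_Int[OF assms(1-3)] assms(4,5) by blast
qed

text \<open>Count pairs of an avoiding subspace \<open>U\<close> and a hyperplane above it. By
  \<open>card_hyperplanes_above\<close>, a \<open>U\<close> of dimension \<open>j\<close> has
  \<open>(q^n - q^j) / ((q - 1) q^j)\<close> of them; \<open>\<alpha>\<close> supplies the factor
  \<open>q^j\<close>.\<close>

lemma avoid_poly_average:
  fixes V :: "(nat \<Rightarrow> 'k::{field,finite}) set"
  assumes "finite V" "coord.subspace V"
  shows "smult (real CARD('k) ^ coord.dim V) (avoid_poly V A) - alpha CARD('k) (avoid_poly V A) =
    smult (real CARD('k) - 1) (alpha CARD('k) (\<Sum>p\<in>hyperplanes V - A. avoid_poly p ((\<inter>) p ` A)))"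
proof -
  let ?q = "real CARD('k)" and ?n = "coord.dim V"
  let ?S = "{U. coord.subspace U \<and> U \<subseteq> V \<and> (\<forall>a\<in>A. \<not> U \<subseteq> a)}"
  let ?m = "\<lambda>U. monom (1::real) (coord.dim U)"
  have finS: "finite ?S" by (rule finite_subspaces) fact
  have finH: "finite (hyperplanes V - A)" using finite_hyperplanes[OF assms(1)] by simp
  have "(\<Sum>p\<in>hyperplanes V - A. avoid_poly p ((\<inter>) p ` A)) =
        (\<Sum>p\<in>hyperplanes V - A. \<Sum>U\<in>?S. if U \<subseteq> p then ?m U else 0)"
    using finS by (intro sum.cong) (auto simp: avoid_poly_hyperplane sum.inter_filter[symmetric])
  also have "\<dots> = (\<Sum>U\<in>?S. \<Sum>p\<in>hyperplanes V - A. if U \<subseteq> p then ?m U else 0)"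
    by (rule sum.swap)
  also have "\<dots> = (\<Sum>U\<in>?S. smult (real (card {p\<in>hyperplanes V. U \<subseteq> p})) (?m U))"
  proof (intro sum.cong refl)
    fix U assume U: "U \<in> ?S"
    \<comment> \<open>Since \<open>U\<close> avoids \<open>A\<close>, no hyperplane above it belongs
      to \<open>A\<close>.\<close>
    have "{p\<in>hyperplanes V - A. U \<subseteq> p} = {p\<in>hyperplanes V. U \<subseteq> p}" using U by auto
    then show "(\<Sum>p\<in>hyperplanes V - A. if U \<subseteq> p then ?m U else 0) =
        smult (real (card {p\<in>hyperplanes V. U \<subseteq> p})) (?m U)"
      using finH by (simp add: sum.inter_filter[symmetric] of_nat_poly)
  qed
  finally have "smult (?q - 1) (alpha CARD('k) (\<Sum>p\<in>hyperplanes V - A. avoid_poly p ((\<inter>) p ` A)))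
     = (\<Sum>U\<in>?S. smult (real (card {p\<in>hyperplanes V. U \<subseteq> p}) * (?q - 1) * ?q ^ coord.dim U) (?m U))"
    by (simp add: alpha_sum alpha_smult alpha_monom smult_sum_right smult_monom algebra_simps)
  also have "\<dots> = (\<Sum>U\<in>?S. smult (?q ^ ?n - ?q ^ coord.dim U) (?m U))"
    by (intro sum.cong refl) (simp add: card_hyperplanes_above[OF assms])
  finally show ?thesis
    by (simp add: avoid_poly_def alpha_sum alpha_monom smult_sum_right smult_monom sum_subtractf[symmetric]
        diff_monom)
qed

text \<open>Supplies the coefficient that the averaging identity cannot see.\<close>

lemma coeff_avoid_poly_top:
  fixes V :: "(nat \<Rightarrow> 'k::{field,finite}) set"
  assumes "finite V" "coord.subspace V" "A \<subseteq> hyperplanes V"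
  shows "coeff (avoid_poly V A) (coord.dim V) = 1"
proof -
  let ?S = "{U. coord.subspace U \<and> U \<subseteq> V \<and> (\<forall>a\<in>A. \<not> U \<subseteq> a)}"
  have "coeff (avoid_poly V A) (coord.dim V) = (\<Sum>U\<in>?S. if U = V then 1 else 0)"
    unfolding avoid_poly_def coeff_sum
    using assms subspace_eq_of_dim_le[of _ V] by (intro sum.cong) auto
  also have "\<dots> = 1"
  proof -
    have "V \<in> ?S"
    proof -
      have False if "a \<in> A" "V \<subseteq> a" for a
      proof -
        from that assms have "a = V" "Suc (coord.dim a) = coord.dim V" by (auto simp: hyperplanes_def)
        then show False by simp
      qed
      then show ?thesis using assms by auto
    qed
    then show ?thesis using finite_subspaces[OF assms(1)] by simp
  qed
  finally show ?thesis .
qed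

text \<open>Both sides have the same q-derivative, by induction and because there are
  \<open>(q^n - 1) / (q - 1)\<close> hyperplanes, and the same coefficient of
  \<open>t^n\<close>.\<close>

lemma avoid_poly_empty:
  fixes V :: "(nat \<Rightarrow> 'k::{field,finite}) set"
  assumes "finite V" "coord.subspace V"
  shows "avoid_poly V {} = R_poly CARD('k) (coord.dim V) 0"
  using assms
proof (induction "coord.dim V" arbitrary: V rule: less_induct)
  case less
  let ?q = "real CARD('k)" and ?n = "coord.dim V"
  let ?R = "R_poly CARD('k) ?n 0" and ?R' = "R_poly CARD('k) (?n - 1) 0"
  have "(\<Sum>p\<in>hyperplanes V - {}. avoid_poly p ((\<inter>) p ` {})) = (\<Sum>p\<in>hyperplanes V. ?R')"
  proof (rule sum.cong)
    fix p assume "p \<in> hyperplanes V"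
    then have p: "finite p" "coord.subspace p" "Suc (coord.dim p) = coord.dim V"
      using hyperplane_restriction[OF less.prems, of p "{}"] by auto
    then have "?n - 1 = coord.dim p" by simp
    then show "avoid_poly p ((\<inter>) p ` {}) = ?R'"
      using less.hyps[OF _ p(1,2)] p(3) by simp
  qed simp
  then have "smult (?q ^ ?n) (avoid_poly V {}) - alpha CARD('k) (avoid_poly V {}) =
     smult (?q - 1) (alpha CARD('k) (smult (real (card (hyperplanes V))) ?R'))"
    using avoid_poly_average[OF less.prems, of "{}"] by (simp add: of_nat_poly)
  also have "\<dots> = smult (?q ^ ?n - 1) (alpha CARD('k) ?R')"
  proof -
    have "{H\<in>hyperplanes V. {0} \<subseteq> H} = hyperplanes V"
      by (auto simp: hyperplanes_def coord.subspace_0)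
    then have "real (card (hyperplanes V)) * (?q - 1) = ?q ^ ?n - 1"
      using card_hyperplanes_above[OF less.prems, of "{0}"] less.prems
      by (simp add: coord.subspace_0 dim_zero_space)
    then show ?thesis by (simp add: alpha_smult mult.commute)
  qed
  also have "\<dots> = smult (?q ^ ?n) ?R - alpha CARD('k) ?R"
    using R_poly_q_derivative[of 0 ?n "CARD('k)"] by simp
  finally have "smult (?q ^ ?n) (avoid_poly V {} - ?R) = alpha CARD('k) (avoid_poly V {} - ?R)"
    by (simp add: poly_eq_iff coeff_alpha algebra_simps)
  from q_derivative_eq_0D[OF card_field_ge_2 this] show ?case
    using coeff_avoid_poly_top[OF less.prems, of "{}"] coeff_R_poly_top[of 0 ?n "CARD('k)"] by simp
qed

text \<open>Without hyperplanes the functional gives 1 in dimension 0 and 0 otherwise. Adding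
  \<open>p\<close> to \<open>A\<close> subtracts the value on \<open>p\<close>, where the dimension
  is one lower and the sign therefore opposite.\<close>

lemma sign_avoid_poly:
  fixes V :: "(nat \<Rightarrow> 'k::{field,finite}) set"
  assumes "finite V" "coord.subspace V" "A \<subseteq> hyperplanes V"
  shows "0 \<le> (-1) ^ coord.dim V * lin_ext (sign_seq CARD('k)) (avoid_poly V A)"
  using assms
proof (induction "coord.dim V" arbitrary: V A rule: less_induct)
  case less
  have "finite A" using finite_hyperplanes[OF less.prems(1)] less.prems(3) finite_subset by blast
  then show ?case using less.prems(3)
  proof (induction A)
    case empty
    show ?case
    proof (cases "coord.dim V = 0")
      case True
      then show ?thesis
        using less.prems
        by (simp add: avoid_poly_empty R_poly_self lin_ext_monom sign_seq_def del: monom_0 monom_eq_1)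
    next
      case False
      then show ?thesis using less.prems by (simp add: avoid_poly_empty lin_ext_sign_seq_R_poly)
    qed
  next
    case (insert p A)
    note p = hyperplane_restriction[OF less.prems(1,2), of p A]
    have "0 \<le> (-1) ^ coord.dim p * lin_ext (sign_seq CARD('k)) (avoid_poly p ((\<inter>) p ` A))"
      using p insert by (intro less) auto
    moreover have "lin_ext (sign_seq CARD('k)) (avoid_poly V A) =
        lin_ext (sign_seq CARD('k)) (avoid_poly V (insert p A)) +
        lin_ext (sign_seq CARD('k)) (avoid_poly p ((\<inter>) p ` A))"
      using avoid_poly_insert[OF less.prems(1), of p A] insert.prems by (simp add: lin_ext_add)
    moreover have "(-1 :: real) ^ coord.dim V = - ((-1) ^ coord.dim p)"
      using p(3) insert by (simp flip: p(3))
    ultimately show ?case using insert.IH insert.prems by (simp add: algebra_simps)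
  qed
qed

text \<open>
  The coefficients \<open>h\<^sub>k\<close> with \<open>k < dim V\<close> come from averaging over the hyperplanes outside \<open>A\<close>,
  which does not see \<open>t\<^sup>n\<close>; the functional \<open>sign_seq\<close> kills all other \<open>R_poly\<close> and so gives \<open>h\<^sub>n\<close>.
\<close>
lemma avoid_poly_positive:
  fixes V :: "(nat \<Rightarrow> 'k::{field,finite}) set"
  assumes "finite V" "coord.subspace V" "A \<subseteq> hyperplanes V"
  shows "\<exists>h. (\<forall>k. 0 \<le> h k) \<and>
    avoid_poly V A = (\<Sum>k\<le>coord.dim V. smult (h k) (R_poly CARD('k) (coord.dim V) k))"
  using assms
proof (induction "coord.dim V" arbitrary: V A rule: less_induct)
  case less
  let ?q = "real CARD('k)" and ?n = "coord.dim V"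
  let ?R = "R_poly CARD('k) ?n" and ?R' = "R_poly CARD('k) (?n - 1)"
  have q: "?q > 1" using card_field_ge_2[where 'k='k] by simp
  have "\<forall>p\<in>hyperplanes V - A. \<exists>h. (\<forall>k. 0 \<le> h k) \<and>
    avoid_poly p ((\<inter>) p ` A) = (\<Sum>k<?n. smult (h k) (?R' k))"
  proof
    fix p assume "p \<in> hyperplanes V - A"
    then have p: "finite p" "coord.subspace p" "Suc (coord.dim p) = coord.dim V"
        "(\<inter>) p ` A \<subseteq> hyperplanes p"
      using hyperplane_restriction[OF less.prems(1,2), of p A] less.prems(3) by auto
    have "{..coord.dim p} = {..<?n}" "?n - 1 = coord.dim p" using p(3) by auto
    then show "\<exists>h. (\<forall>k. 0 \<le> h k) \<and>
        avoid_poly p ((\<inter>) p ` A) = (\<Sum>k<?n. smult (h k) (?R' k))"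
      using less.hyps[OF _ p(1,2,4)] p(3) by auto
  qed
  then obtain h where h: "\<And>p k. p \<in> hyperplanes V - A \<Longrightarrow> 0 \<le> h p k"
    "\<And>p. p \<in> hyperplanes V - A \<Longrightarrow> avoid_poly p ((\<inter>) p ` A) = (\<Sum>k<?n. smult (h p k) (?R' k))"
    by metis
  \<comment> \<open>The value that makes \<open>H k * (q^n - q^k)\<close> the coefficient of
    \<open>\<alpha> R_{n-1,k}\<close> in the averaged polynomial.\<close>
  define H where "H k = (?q - 1) * (\<Sum>p\<in>hyperplanes V - A. h p k) / (?q ^ ?n - ?q ^ k)" for k
  have H_nonneg: "0 \<le> H k" if "k < ?n" for k
    unfolding H_def using q h that by (intro divide_nonneg_nonneg mult_nonneg_nonneg sum_nonneg) auto
  define d where "d = avoid_poly V A - (\<Sum>k<?n. smult (H k) (?R k))"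
  have "(\<Sum>p\<in>hyperplanes V - A. avoid_poly p ((\<inter>) p ` A)) =
      (\<Sum>k<?n. smult (\<Sum>p\<in>hyperplanes V - A. h p k) (?R' k))"
    using h(2) by (simp add: smult_sum) (rule sum.swap)
  then have "smult (?q ^ ?n) (avoid_poly V A) - alpha CARD('k) (avoid_poly V A) =
      (\<Sum>k<?n. smult ((?q - 1) * (\<Sum>p\<in>hyperplanes V - A. h p k)) (alpha CARD('k) (?R' k)))"
    unfolding avoid_poly_average[OF less.prems(1,2)]
    by (simp add: alpha_sum alpha_smult smult_sum_right)
  also have "\<dots> = (\<Sum>k<?n. smult (H k) (smult (?q ^ ?n - ?q ^ k) (alpha CARD('k) (?R' k))))"
    using q by (intro sum.cong) (auto simp: H_def power_inject_exp)
  also have "\<dots> = (\<Sum>k<?n. smult (H k) (smult (?q ^ ?n) (?R k) - alpha CARD('k) (?R k)))"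
    by (intro sum.cong) (simp_all add: R_poly_q_derivative)
  finally have "smult (?q ^ ?n) d = alpha CARD('k) d"
    unfolding d_def poly_eq_iff
    by (simp add: coeff_alpha coeff_sum sum_distrib_left algebra_simps sum_subtractf)
  from q_derivative_eq_0D[OF card_field_ge_2 this]
  obtain c where c: "d = monom c ?n" by blast
  have eq: "avoid_poly V A = (\<Sum>k<?n. smult (H k) (?R k)) + monom c ?n"
    using c by (simp add: d_def algebra_simps)
  have "lin_ext (sign_seq CARD('k)) (avoid_poly V A) = c * sign_seq CARD('k) ?n"
    by (simp add: eq lin_ext_add lin_ext_sum lin_ext_smult lin_ext_sign_seq_R_poly lin_ext_monom)
  then have "0 \<le> (-1) ^ ?n * (c * sign_seq CARD('k) ?n)"
    using sign_avoid_poly[OF less.prems] by simp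
  also have "(-1) ^ ?n * (c * sign_seq CARD('k) ?n) = c * ?q ^ (\<Sum>i<?n. i)"
    by (simp add: sign_seq_def power_mult_distrib[symmetric] mult.left_commute flip: mult.assoc)
  finally have "0 \<le> c * ?q ^ (\<Sum>i<?n. i)" .
  moreover have "?q ^ (\<Sum>i<?n. i) > 0" using q by (intro zero_less_power) simp
  ultimately have "c \<ge> 0" by (simp add: zero_le_mult_iff)
  have "avoid_poly V A = (\<Sum>k\<le>?n. smult ((H(?n := c)) k) (?R k))"
    unfolding eq by (simp add: lessThan_Suc_atMost[symmetric] R_poly_self smult_monom)
  \<comment> \<open>For \<open>k > n\<close> the denominator in \<open>H\<close> is negative, so
    these entries are reset to 0 to have nonnegativity for every \<open>k\<close>.\<close>
  then have "avoid_poly V A = (\<Sum>k\<le>?n. smult (if k \<le> ?n then (H(?n := c)) k else 0) (?R k))"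
    by simp
  moreover have "\<forall>k. 0 \<le> (if k \<le> ?n then (H(?n := c)) k else 0)"
    using H_nonneg \<open>c \<ge> 0\<close> by auto
  ultimately show ?case by (intro exI[of _ "\<lambda>k. if k \<le> ?n then (H(?n := c)) k else 0"] conjI)
qed

section \<open>Shellable posets\<close>

lemma chain_iff:
  "pred_on.chain P (\<le>) C \<longleftrightarrow> C \<subseteq> P \<and> (\<forall>x\<in>C. \<forall>y\<in>C. x \<le> y \<or> y \<le> x)"
  for P :: "'a::order set"
  unfolding pred_on.chain_def by auto

lemma finite_chains: "finite P \<Longrightarrow> finite {C. pred_on.chain P (\<le>) C}"
  for P :: "'a::order set"
  by (rule finite_subset[of _ "Pow P"]) (auto simp: chain_iff)

lemma finite_chain_lengths: "finite P \<Longrightarrow> finite {card C - 1 | C. pred_on.chain P (\<le>) C}"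
  for P :: "'a::order set"
  using finite_chains[of P] by simp

lemma card_chain_le:
  fixes P :: "'a::order set"
  assumes "finite P" "pred_on.chain P (\<le>) C"
  shows "card C \<le> Suc (poset_rank P)"
proof -
  have "card C - 1 \<le> poset_rank P"
    unfolding poset_rank_def using assms by (intro Max_ge finite_chain_lengths) auto
  then show ?thesis by simp
qed

lemma exists_longest_chain:
  fixes P :: "'a::order set"
  assumes "finite P" "P \<noteq> {}"
  shows "\<exists>C. pred_on.chain P (\<le>) C \<and> card C = Suc (poset_rank P)"
proof -
  have "{card C - 1 | C. pred_on.chain P (\<le>) C} \<noteq> {}" by (auto simp: chain_iff)
  then have "poset_rank P \<in> {card C - 1 | C. pred_on.chain P (\<le>) C}"
    unfolding poset_rank_def using finite_chain_lengths[OF assms(1)] by (rule Max_in[rotated])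
  then obtain C where C: "pred_on.chain P (\<le>) C" "poset_rank P = card C - 1" by auto
  obtain x where "x \<in> P" using assms by auto
  then have x: "pred_on.chain P (\<le>) {x}" by (simp add: chain_iff)
  show ?thesis
  proof (cases "card C = 0")
    \<comment> \<open>By truncated subtraction the empty chain also counts as length 0; a singleton
      replaces it.\<close>
    case True
    then show ?thesis using C x by (intro exI[of _ "{x}"]) simp
  next
    case False
    then show ?thesis using C by (intro exI[of _ C]) simp
  qed
qed

lemma poset_rank_eqI:
  fixes P :: "'a::order set"
  assumes "finite P" "pred_on.chain P (\<le>) C" "card C = Suc d"
    "\<And>C. pred_on.chain P (\<le>) C \<Longrightarrow> card C \<le> Suc d"
  shows "poset_rank P = d"
  unfolding poset_rank_def
proof (rule Max_eqI)
  show "finite {card C - 1 | C. pred_on.chain P (\<le>) C}" by (rule finite_chain_lengths) fact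
  show "d \<in> {card C - 1 | C. pred_on.chain P (\<le>) C}" using assms(2,3) by force
  show "y \<le> d" if "y \<in> {card C - 1 | C. pred_on.chain P (\<le>) C}" for y
    using that assms(4) by force
qed

lemma poset_rank_order_isomorphic:
  fixes A :: "'a::order set" and B :: "'b::order set"
  assumes "finite A" "A \<noteq> {}" "order_isomorphic A B"
  shows "poset_rank A = poset_rank B"
proof -
  obtain f where f: "bij_betw f A B" "\<And>x y. x \<in> A \<Longrightarrow> y \<in> A \<Longrightarrow> x \<le> y \<longleftrightarrow> f x \<le> f y"
    using assms(3) unfolding order_isomorphic_def by blast
  have fin: "finite B" "B \<noteq> {}" using f(1) assms(1,2) by (auto simp: bij_betw_def)
  obtain C where C: "pred_on.chain B (\<le>) C" "card C = Suc (poset_rank B)"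
    using exists_longest_chain[OF fin] by blast
  let ?g = "inv_into A f"
  have g: "?g y \<in> A" "f (?g y) = y" if "y \<in> B" for y
    using that f(1) by (auto simp: bij_betw_def inv_into_into f_inv_into_f)
  show ?thesis
  proof (rule poset_rank_eqI[OF assms(1)])
    show "pred_on.chain A (\<le>) (?g ` C)"
      using C(1) g f(2) unfolding chain_iff by (auto simp: subset_iff)
    show "card (?g ` C) = Suc (poset_rank B)"
      using C g by (subst card_image) (auto simp: chain_iff intro!: inj_on_inverseI[of _ f])
  next
    fix D assume D: "pred_on.chain A (\<le>) D"
    have "pred_on.chain B (\<le>) (f ` D)"
      unfolding chain_iff
    proof (intro conjI ballI)
      show "f ` D \<subseteq> B" using D f(1) by (auto simp: chain_iff bij_betw_def)
      fix u v assume "u \<in> f ` D" "v \<in> f ` D"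
      then obtain x y where "x \<in> D" "y \<in> D" "u = f x" "v = f y" by blast
      moreover from this have "x \<in> A" "y \<in> A" "x \<le> y \<or> y \<le> x" using D by (auto simp: chain_iff)
      ultimately show "u \<le> v \<or> v \<le> u" using f(2)[of x y] f(2)[of y x] by simp
    qed
    moreover have "card (f ` D) = card D"
      using D f(1) by (intro card_image) (auto simp: chain_iff bij_betw_def intro: inj_on_subset)
    ultimately show "card D \<le> Suc (poset_rank B)"
      using card_chain_le[OF fin(1), of "f ` D"] by simp
  qed
qed

text \<open>Does not refer to a field, so it makes sense in any finite poset;
  \<open>q_rank_eq\<close> identifies it with \<open>q_rank\<close> on q-posets.\<close>

definition elt_rank :: "'a::order set \<Rightarrow> 'a \<Rightarrow> nat" where
  "elt_rank P x = poset_rank (pideal P x)"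

lemma finite_pideal: "finite P \<Longrightarrow> finite (pideal P x)"
  by (simp add: pideal_def)

lemma elt_rank_chain:
  assumes "finite P" "x \<in> P"
  shows "\<exists>C. pred_on.chain (pideal P x) (\<le>) C \<and> card C = Suc (elt_rank P x) \<and> x \<in> C"
proof -
  have ne: "pideal P x \<noteq> {}" using assms by (auto simp: pideal_def)
  obtain C where C: "pred_on.chain (pideal P x) (\<le>) C" "card C = Suc (elt_rank P x)"
    unfolding elt_rank_def using exists_longest_chain[OF finite_pideal[OF assms(1)] ne] by blast
  have "pred_on.chain (pideal P x) (\<le>) (insert x C)"
    using C(1) assms by (auto simp: chain_iff pideal_def)
  then have "card (insert x C) \<le> Suc (elt_rank P x)"
    unfolding elt_rank_def by (rule card_chain_le[OF finite_pideal[OF assms(1)]])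
  moreover have "finite C" using C(2) card.infinite by fastforce
  ultimately have "x \<in> C" using C(2) by (auto simp: card_insert_if split: if_splits)
  then show ?thesis using C by blast
qed

lemma elt_rank_less:
  assumes "finite P" "x \<in> P" "y \<in> P" "x < y"
  shows "elt_rank P x < elt_rank P y"
proof -
  obtain C where C: "pred_on.chain (pideal P x) (\<le>) C" "card C = Suc (elt_rank P x)"
    using elt_rank_chain[OF assms(1,2)] by blast
  have "pred_on.chain (pideal P y) (\<le>) (insert y C)"
    using C(1) assms less_imp_le[OF assms(4)] unfolding chain_iff pideal_def
    by (auto intro: order_trans)
  then have "card (insert y C) \<le> Suc (elt_rank P y)"
    unfolding elt_rank_def by (rule card_chain_le[OF finite_pideal[OF assms(1)]])
  moreover have "y \<notin> C" using C(1) assms(4) by (auto simp: chain_iff pideal_def)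
  moreover have "finite C" using C(2) card.infinite by fastforce
  ultimately show ?thesis using C(2) by simp
qed

lemma elt_rank_mono:
  assumes "finite P" "x \<in> P" "y \<in> P" "x \<le> y"
  shows "elt_rank P x \<le> elt_rank P y"
  using elt_rank_less[OF assms(1-3)] assms(4) by (auto simp: le_less)

lemma exists_facet_ge:
  assumes "finite P" "x \<in> P"
  shows "\<exists>y\<in>facets P. x \<le> y"
  using finite_has_maximal2[OF assms] unfolding facets_def by (force simp: less_le)

text \<open>A longest chain below a facet \<open>x\<close> is a maximal chain of \<open>Q\<close>: a
  larger chain contains \<open>x\<close>, hence has \<open>x\<close> as its top, and stays in the
  ideal of \<open>x\<close>. Purity compares it with a longest chain of \<open>Q\<close>.\<close>

lemma elt_rank_facet:
  assumes "finite Q" "pure_poset Q" "x \<in> facets Q"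
  shows "elt_rank Q x = poset_rank Q"
proof -
  have x: "x \<in> Q" "\<And>y. y \<in> Q \<Longrightarrow> \<not> x < y" using assms(3) by (auto simp: facets_def)
  obtain C where C: "pred_on.chain (pideal Q x) (\<le>) C" "card C = Suc (elt_rank Q x)" "x \<in> C"
    using elt_rank_chain[OF assms(1) x(1)] by blast
  have mC: "pred_on.maxchain Q (\<le>) C"
    unfolding pred_on.maxchain_def
  proof (intro conjI notI)
    show "pred_on.chain Q (\<le>) C" using C(1) by (auto simp: chain_iff pideal_def)
    assume "\<exists>S. pred_on.chain Q (\<le>) S \<and> C \<subset> S"
    then obtain S where S: "pred_on.chain Q (\<le>) S" "C \<subset> S" by blast
    have "z \<le> x" if "z \<in> S" for z
      using S C(3) x(2)[of z] that by (auto simp: chain_iff less_le)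
    then have "pred_on.chain (pideal Q x) (\<le>) S"
      using S(1) by (auto simp: chain_iff pideal_def)
    then have "card S \<le> Suc (elt_rank Q x)"
      unfolding elt_rank_def by (rule card_chain_le[OF finite_pideal[OF assms(1)]])
    moreover have "card C < card S"
      using S assms(1) by (intro psubset_card_mono) (auto simp: chain_iff intro: finite_subset)
    ultimately show False using C(2) by simp
  qed
  have "Q \<noteq> {}" using x by auto
  then obtain D where D: "pred_on.chain Q (\<le>) D" "card D = Suc (poset_rank Q)"
    using exists_longest_chain[OF assms(1)] by blast
  have "pred_on.maxchain Q (\<le>) D"
    unfolding pred_on.maxchain_def
  proof (intro conjI notI D)
    assume "\<exists>S. pred_on.chain Q (\<le>) S \<and> D \<subset> S"
    then obtain S where S: "pred_on.chain Q (\<le>) S" "D \<subset> S" by blast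
    have "card D < card S"
      using S assms(1) by (intro psubset_card_mono) (auto simp: chain_iff intro: finite_subset)
    then show False using card_chain_le[OF assms(1) S(1)] D(2) by simp
  qed
  then have "card C = card D" using assms(2) mC unfolding pure_poset_def by blast
  then show ?thesis using C D by simp
qed

section \<open>The lattice of subspaces as a poset\<close>

abbreviation subspaces :: "(nat \<Rightarrow> 'k::{field,finite}) set \<Rightarrow> (nat \<Rightarrow> 'k) set set" where
  "subspaces V \<equiv> {U. coord.subspace U \<and> U \<subseteq> V}"

lemma hyperplane_exists:
  fixes V :: "(nat \<Rightarrow> 'k::{field,finite}) set"
  assumes "finite V" "coord.subspace V" "0 < coord.dim V"
  shows "hyperplanes V \<noteq> {}"
proof
  assume "hyperplanes V = {}"
  then have "real CARD('k) ^ coord.dim V = 1"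
    using card_hyperplanes_above[OF assms(1,2), of "{0}"] assms(2)
    by (simp add: coord.subspace_0 dim_zero_space)
  moreover have "1 < real CARD('k) ^ coord.dim V"
    using card_field_ge_2[where 'k='k] assms(3) by (intro one_less_power) auto
  ultimately show False by simp
qed

lemma subspaces_chain:
  fixes V :: "(nat \<Rightarrow> 'k::{field,finite}) set"
  assumes "finite V" "coord.subspace V"
  shows "\<exists>C. pred_on.chain (subspaces V) (\<le>) C \<and> card C = Suc (coord.dim V)"
  using assms
proof (induction "coord.dim V" arbitrary: V rule: less_induct)
  case less
  show ?case
  proof (cases "coord.dim V = 0")
    case True
    then show ?thesis using less.prems by (intro exI[of _ "{V}"]) (simp add: chain_iff)
  next
    case False
    then obtain H where H: "coord.subspace H" "H \<subseteq> V" "Suc (coord.dim H) = coord.dim V"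
      using hyperplane_exists[OF less.prems] by (auto simp: hyperplanes_def)
    have fin: "finite H" using H less.prems by (auto intro: finite_subset)
    obtain C where C: "pred_on.chain (subspaces H) (\<le>) C" "card C = Suc (coord.dim H)"
      using less.hyps[OF _ fin H(1)] H(3) by auto
    have "V \<notin> C"
    proof
      assume "V \<in> C"
      then have "H = V" using C(1) H(2) by (auto simp: chain_iff)
      then show False using H(3) by simp
    qed
    moreover have "finite C" using C(2) card.infinite by fastforce
    moreover have "pred_on.chain (subspaces V) (\<le>) (insert V C)"
      using C(1) H(2) less.prems unfolding chain_iff by blast
    ultimately show ?thesis using C(2) H(3) by (intro exI[of _ "insert V C"]) simp
  qed
qed

text \<open>A complete flag attains the rank, and no chain is longer because \<open>dim\<close> is
  injective on chains.\<close>

lemma poset_rank_subspaces: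
  fixes V :: "(nat \<Rightarrow> 'k::{field,finite}) set"
  assumes "finite V" "coord.subspace V"
  shows "poset_rank (subspaces V) = coord.dim V"
proof -
  obtain C where C: "pred_on.chain (subspaces V) (\<le>) C" "card C = Suc (coord.dim V)"
    using subspaces_chain[OF assms] by blast
  show ?thesis
  proof (rule poset_rank_eqI[OF _ C])
    show "finite (subspaces V)" using finite_subspaces[OF assms(1), of "\<lambda>_. True"] by simp
    fix D assume D: "pred_on.chain (subspaces V) (\<le>) D"
    have "inj_on coord.dim D"
    proof (rule inj_onI)
      fix U W assume UW: "U \<in> D" "W \<in> D" "coord.dim U = coord.dim W"
      then have "coord.subspace U" "coord.subspace W" "finite U" "finite W" "U \<subseteq> W \<or> W \<subseteq> U"
        using D assms(1) finite_subset[of _ V] by (auto simp: chain_iff)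
      then show "U = W" using subspace_eq_of_dim_le[of U W] subspace_eq_of_dim_le[of W U] UW by auto
    qed
    moreover have "coord.dim ` D \<subseteq> {..coord.dim V}"
      using D assms by (auto simp: chain_iff intro!: dim_subspace_le)
    ultimately have "card D \<le> card {..coord.dim V}" by (intro card_inj_on_le) auto
    then show "card D \<le> Suc (coord.dim V)" by simp
  qed
qed

lemma subspace_coord_space: "coord.subspace (coord_space n)"
  by (rule coord.subspaceI) (simp_all add: coord_space_def coord_scale_def)

lemma coord_space_Suc:
  fixes e :: "nat \<Rightarrow> nat \<Rightarrow> 'k::field"
  defines "e \<equiv> \<lambda>n i. if i = n then 1 else 0"
  shows "coord_space (Suc n) = coord.span (insert (e n) (coord_space n))"
proof
  have "coord_space n \<subseteq> coord_space (Suc n)" "e n \<in> coord_space (Suc n)"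
    by (auto simp: coord_space_def e_def)
  then show "coord.span (insert (e n) (coord_space n)) \<subseteq> coord_space (Suc n)"
    by (intro coord.span_minimal subspace_coord_space) simp
  show "coord_space (Suc n) \<subseteq> coord.span (insert (e n) (coord_space n))"
  proof
    fix v :: "nat \<Rightarrow> 'k" assume v: "v \<in> coord_space (Suc n)"
    have "(v - coord_scale (v n) (e n)) i = 0" if "i \<ge> n" for i
    proof (cases "i = n")
      case False
      then have "v i = 0" using v that by (simp add: coord_space_def)
      then show ?thesis using False by (simp add: coord_scale_def e_def)
    qed (simp add: coord_scale_def e_def)
    then have "v - coord_scale (v n) (e n) \<in> coord_space n" unfolding coord_space_def by blast
    then show "v \<in> coord.span (insert (e n) (coord_space n))"
      unfolding coord.span_breakdown_eq by (intro exI[of _ "v n"] coord.span_base)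
  qed
qed

lemma finite_dim_coord_space:
  "finite (coord_space n :: (nat \<Rightarrow> 'k::{field,finite}) set) \<and>
   coord.dim (coord_space n :: (nat \<Rightarrow> 'k) set) = n"
proof (induction n)
  case 0
  have "coord_space 0 = {0 :: nat \<Rightarrow> 'k}" by (auto simp: coord_space_def)
  then show ?case by (simp add: dim_zero_space)
next
  case (Suc n)
  have "(\<lambda>i. if i = n then 1 else 0) \<notin> (coord_space n :: (nat \<Rightarrow> 'k) set)"
    by (auto simp: coord_space_def)
  from dim_span_insert[OF subspace_coord_space conjunct1[OF Suc] this] conjunct2[OF Suc]
  show ?case unfolding coord_space_Suc by simp
qed

lemmas coord_space_props =
  subspace_coord_space finite_dim_coord_space[THEN conjunct1] finite_dim_coord_space[THEN conjunct2]

lemma subspace_lattice_eq: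
  "subspace_lattice TYPE('k) n = subspaces (coord_space n :: (nat \<Rightarrow> 'k::{field,finite}) set)"
  by (simp add: subspace_lattice_def)

lemma poset_rank_subspace_lattice: "poset_rank (subspace_lattice TYPE('k::{field,finite}) n) = n"
  by (simp add: subspace_lattice_eq poset_rank_subspaces coord_space_props)

text \<open>Isomorphic posets have equal rank, so \<open>d\<close> is unique and the description in
  \<open>q_rank\<close> is well defined.\<close>

lemma order_isomorphic_rank:
  fixes P :: "'a::order set"
  assumes "finite P" "x \<in> P" "order_isomorphic (pideal P x) (subspace_lattice TYPE('k::{field,finite}) d)"
  shows "d = elt_rank P x"
proof -
  have "pideal P x \<noteq> {}" using assms by (auto simp: pideal_def)
  then show ?thesis
    using poset_rank_order_isomorphic[OF finite_pideal[OF assms(1)] _ assms(3)]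
    by (simp add: poset_rank_subspace_lattice elt_rank_def)
qed

section \<open>Principal ideals of q-posets\<close>

lemma q_poset_isomorphic:
  fixes P :: "'a::order set"
  assumes "q_poset TYPE('k::{field,finite}) P" "x \<in> P"
  shows "order_isomorphic (pideal P x) (subspace_lattice TYPE('k) (elt_rank P x))"
proof -
  obtain d where d: "order_isomorphic (pideal P x) (subspace_lattice TYPE('k) d)"
    using assms unfolding q_poset_def by blast
  have "finite P" using assms(1) unfolding q_poset_def by (rule conjunct1)
  then have "d = elt_rank P x" using assms(2) d by (rule order_isomorphic_rank)
  then show ?thesis using d by simp
qed

lemma q_rank_eq:
  fixes P :: "'a::order set"
  assumes "q_poset TYPE('k::{field,finite}) P" "x \<in> P"
  shows "q_rank TYPE('k) P x = elt_rank P x"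
  unfolding q_rank_def
proof (rule the_equality)
  show "order_isomorphic (pideal P x) (subspace_lattice TYPE('k) (elt_rank P x))"
    by (rule q_poset_isomorphic) fact+
  have "finite P" using assms(1) unfolding q_poset_def by (rule conjunct1)
  then show "d = elt_rank P x"
    if "order_isomorphic (pideal P x) (subspace_lattice TYPE('k) d)" for d
    using assms(2) that by (rule order_isomorphic_rank)
qed

text \<open>Transport along an isomorphism from the ideal of \<open>x\<close> to the subspaces of
  \<open>V\<close>, under which coatoms become hyperplanes. The clause on empty \<open>A\<close>
  lets \<open>rank_sum_pideal\<close> treat the whole ideal.\<close>

lemma avoiding_rank_sum:
  fixes P :: "'a::order set"
  assumes "q_poset TYPE('k::{field,finite}) P" "x \<in> P"
    and A: "\<And>a. a \<in> A \<Longrightarrow> a \<in> P \<and> a \<le> x \<and> Suc (elt_rank P a) = elt_rank P x"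
  defines "V \<equiv> coord_space (elt_rank P x) :: (nat \<Rightarrow> 'k) set"
  shows "\<exists>B. B \<subseteq> hyperplanes V \<and> (A = {} \<longrightarrow> B = {}) \<and>
    (\<Sum>z | z \<in> P \<and> z \<le> x \<and> (\<forall>a\<in>A. \<not> z \<le> a). monom 1 (elt_rank P z)) = avoid_poly V B"
proof -
  have finP: "finite P" using assms(1) by (simp add: q_poset_def)
  have V: "finite V" "coord.subspace V" "coord.dim V = elt_rank P x"
    by (simp_all add: V_def coord_space_props)
  obtain f where f: "bij_betw f (pideal P x) (subspaces V)"
      "\<And>y z. y \<in> pideal P x \<Longrightarrow> z \<in> pideal P x \<Longrightarrow> y \<le> z \<longleftrightarrow> f y \<subseteq> f z"
    using q_poset_isomorphic[OF assms(1,2)]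
    unfolding subspace_lattice_eq V_def[symmetric] order_isomorphic_def by blast
  have fz: "coord.subspace (f z)" "f z \<subseteq> V" "finite (f z)" if "z \<in> pideal P x" for z
  proof -
    have "f z \<in> subspaces V" using bij_betwE[OF f(1)] that by blast
    then show "coord.subspace (f z)" "f z \<subseteq> V" "finite (f z)"
      using finite_subset[OF _ V(1)] by blast+
  qed
  \<comment> \<open>The isomorphism restricts to one from the ideal of \<open>z\<close> onto the
    subspaces of \<open>f z\<close>, so rank becomes dimension.\<close>
  have rank: "elt_rank P z = coord.dim (f z)" if z: "z \<in> pideal P x" for z
  proof -
    have sub: "pideal P z \<subseteq> pideal P x" using z by (auto simp: pideal_def)
    have "f ` pideal P z = subspaces (f z)"
    proof (intro equalityI subsetI)
      fix U assume "U \<in> f ` pideal P z"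
      then obtain y where y: "y \<in> pideal P z" "U = f y" by auto
      then have "y \<in> pideal P x" "y \<le> z" using sub unfolding pideal_def by blast+
      then show "U \<in> subspaces (f z)" using f(2)[of y z] fz(1)[of y] z y by blast
    next
      fix U assume U: "U \<in> subspaces (f z)"
      then have "U \<in> subspaces V" using fz(2)[OF z] by blast
      then have "U \<in> f ` pideal P x" using bij_betw_imp_surj_on[OF f(1)] by simp
      then obtain y where y: "y \<in> pideal P x" "U = f y" by blast
      then have "y \<le> z" using f(2)[of y z] z U by blast
      then show "U \<in> f ` pideal P z" using y unfolding pideal_def by blast
    qed
    then have "bij_betw f (pideal P z) (subspaces (f z))"
      using bij_betw_imageI[OF inj_on_subset[OF bij_betw_imp_inj_on[OF f(1)] sub]] by blast
    moreover have "y \<le> w \<longleftrightarrow> f y \<subseteq> f w" if "y \<in> pideal P z" "w \<in> pideal P z" for y w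
      by (rule f(2)) (rule subsetD[OF sub that(1)], rule subsetD[OF sub that(2)])
    ultimately have "order_isomorphic (pideal P z) (subspaces (f z))"
      unfolding order_isomorphic_def by (intro exI[of _ f]) simp
    moreover have "pideal P z \<noteq> {}" using z by (auto simp: pideal_def)
    ultimately have "poset_rank (pideal P z) = poset_rank (subspaces (f z))"
      by (intro poset_rank_order_isomorphic finite_pideal finP)
    then show ?thesis using poset_rank_subspaces[of "f z"] fz[OF z] by (simp add: elt_rank_def)
  qed
  have Ax: "A \<subseteq> pideal P x" using A by (auto simp: pideal_def)
  have "f ` A \<subseteq> hyperplanes V"
  proof
    fix U assume "U \<in> f ` A"
    then obtain a where a: "a \<in> A" "U = f a" by blast
    then have "a \<in> pideal P x" "Suc (elt_rank P a) = elt_rank P x" using A Ax by auto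
    then show "U \<in> hyperplanes V"
      using rank[of a] fz[of a] a(2) V(3) unfolding hyperplanes_def by simp
  qed
  moreover have "(\<Sum>z | z \<in> P \<and> z \<le> x \<and> (\<forall>a\<in>A. \<not> z \<le> a). monom 1 (elt_rank P z)) = avoid_poly V (f ` A)"
  proof -
    have bij: "bij_betw f {z\<in>P. z \<le> x \<and> (\<forall>a\<in>A. \<not> z \<le> a)}
      {U. coord.subspace U \<and> U \<subseteq> V \<and> (\<forall>a\<in>f ` A. \<not> U \<subseteq> a)}"
      unfolding bij_betw_def
    proof
      show "inj_on f {z\<in>P. z \<le> x \<and> (\<forall>a\<in>A. \<not> z \<le> a)}"
        by (rule inj_on_subset[OF bij_betw_imp_inj_on[OF f(1)]]) (auto simp: pideal_def)
      show "f ` {z\<in>P. z \<le> x \<and> (\<forall>a\<in>A. \<not> z \<le> a)} =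
        {U. coord.subspace U \<and> U \<subseteq> V \<and> (\<forall>a\<in>f ` A. \<not> U \<subseteq> a)}" (is "f ` ?S = ?T")
      proof (intro equalityI subsetI)
        fix U assume "U \<in> f ` ?S"
        then obtain z where z: "z \<in> pideal P x" "\<forall>a\<in>A. \<not> z \<le> a" "U = f z"
          unfolding pideal_def by blast
        have "\<not> f z \<subseteq> f a" if a: "a \<in> A" for a
          using f(2)[OF z(1) subsetD[OF Ax a]] z(2) a by simp
        then show "U \<in> ?T" using fz[OF z(1)] z(3) by simp
      next
        fix U assume U: "U \<in> ?T"
        then have "U \<in> f ` pideal P x" using bij_betw_imp_surj_on[OF f(1)] by blast
        then obtain z where z: "z \<in> pideal P x" "U = f z" by blast
        have "\<not> z \<le> a" if a: "a \<in> A" for a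
        proof -
          have "\<not> f z \<subseteq> f a" using U z(2) a by simp
          then show ?thesis using f(2)[OF z(1) subsetD[OF Ax a]] by simp
        qed
        then show "U \<in> f ` ?S" using z unfolding pideal_def by blast
      qed
    qed
    have "(\<Sum>z | z \<in> P \<and> z \<le> x \<and> (\<forall>a\<in>A. \<not> z \<le> a). monom (1::real) (elt_rank P z)) =
        (\<Sum>z | z \<in> P \<and> z \<le> x \<and> (\<forall>a\<in>A. \<not> z \<le> a). monom 1 (coord.dim (f z)))"
      by (intro sum.cong) (auto simp: rank pideal_def)
    then show ?thesis
      unfolding avoid_poly_def using sum.reindex_bij_betw[OF bij, of "\<lambda>U. monom 1 (coord.dim U)"]
      by (rule trans)
  qed
  ultimately show ?thesis by (intro exI[of _ "f ` A"]) simp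
qed

lemma rank_sum_pideal:
  fixes P :: "'a::order set"
  assumes "q_poset TYPE('k::{field,finite}) P" "x \<in> P"
  shows "(\<Sum>z\<in>pideal P x. monom 1 (elt_rank P z)) = R_poly CARD('k) (elt_rank P x) 0"
  using avoiding_rank_sum[OF assms, of "{}"]
  by (auto simp: avoid_poly_empty coord_space_props pideal_def)

lemma avoiding_rank_sum_positive:
  fixes P :: "'a::order set"
  assumes "q_poset TYPE('k::{field,finite}) P" "x \<in> P"
    and "\<And>a. a \<in> A \<Longrightarrow> a \<in> P \<and> a \<le> x \<and> Suc (elt_rank P a) = elt_rank P x"
  shows "\<exists>h. (\<forall>k. 0 \<le> h k) \<and>
    (\<Sum>z | z \<in> P \<and> z \<le> x \<and> (\<forall>a\<in>A. \<not> z \<le> a). monom 1 (elt_rank P z)) =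
    (\<Sum>k\<le>elt_rank P x. smult (h k) (R_poly CARD('k) (elt_rank P x) k))"
proof -
  obtain B where B: "B \<subseteq> hyperplanes (coord_space (elt_rank P x) :: (nat \<Rightarrow> 'k) set)"
      "(\<Sum>z | z \<in> P \<and> z \<le> x \<and> (\<forall>a\<in>A. \<not> z \<le> a). monom 1 (elt_rank P z)) =
         avoid_poly (coord_space (elt_rank P x)) B"
    using avoiding_rank_sum[OF assms] by blast
  then show ?thesis
    using avoid_poly_positive[OF coord_space_props(2,1) B(1)] by (simp add: coord_space_props)
qed

section \<open>Shellings and the partition of a poset along its facets\<close>

lemma C_shelling_facts:
  assumes "C_shelling P xs"
  shows "finite P" "pure_poset P" "distinct xs" "set xs = facets P"
proof -
  from assms have "finite P \<and> pure_poset P \<and> distinct xs \<and> set xs = facets P"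
    by cases (intro conjI; assumption)+
  then show "finite P" "pure_poset P" "distinct xs" "set xs = facets P" by blast+
qed

text \<open>This makes the facets of \<open>H_j\<close> coatoms of the ideal of \<open>x_j\<close>,
  as the transport to hyperplanes requires.\<close>

lemma shelling_H_facet_rank:
  fixes P :: "'a::order set"
  assumes "C_shelling P xs" "j < length xs" "0 < j" "a \<in> facets (shelling_H P xs j)"
  shows "a \<in> P" "a \<le> xs ! j" "Suc (elt_rank P a) = elt_rank P (xs ! j)"
proof -
  let ?H = "shelling_H P xs j"
  have P: "finite P" "pure_poset P" "distinct xs" "set xs = facets P"
    using C_shelling_facts[OF assms(1)] .
  have a: "a \<in> ?H" using assms(4) by (simp add: facets_def)
  then show aP: "a \<in> P" "a \<le> xs ! j" by (auto simp: shelling_H_def pideal_def)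
  obtain i where i: "i < j" "a \<le> xs ! i" using a by (auto simp: shelling_H_def pideal_def)
  have xf: "xs ! i \<in> facets P" "xs ! j \<in> facets P"
    using assms(2) i P(4)[symmetric] by (auto intro!: nth_mem)
  then have xP: "xs ! i \<in> P" "xs ! j \<in> P" "\<not> xs ! j < xs ! i" by (auto simp: facets_def)
  have "xs ! i \<noteq> xs ! j" using P(3) i assms(2) by (simp add: nth_eq_iff_index_eq)
  then have "a < xs ! j" using aP i xP by (auto simp: less_le)
  then have less: "elt_rank P a < elt_rank P (xs ! j)" using elt_rank_less P aP xP by blast
  have rank: "elt_rank P (xs ! j) = poset_rank P" by (rule elt_rank_facet) fact+
  from assms(1) show "Suc (elt_rank P a) = elt_rank P (xs ! j)"
  proof cases
    \<comment> \<open>Here \<open>a < x_j\<close> alone forces the ranks 0 and 1.\<close>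
    case rank_le_1
    then show ?thesis using less rank by simp
  next
    case rank_ge_2
    have H: "pure_poset ?H" "poset_rank ?H = poset_rank P - 1"
      using rank_ge_2 assms(2,3) by auto
    have "finite ?H" using P(1) by (simp add: shelling_H_def pideal_def)
    then have "elt_rank ?H a = poset_rank ?H" using H(1) assms(4) by (rule elt_rank_facet)
    \<comment> \<open>\<open>H_j\<close> is closed downward in \<open>P\<close>, so \<open>a\<close>
      has the same rank in both.\<close>
    moreover have "pideal ?H a = pideal P a"
      using aP i by (auto simp: shelling_H_def pideal_def intro: order_trans)
    ultimately show ?thesis using H rank rank_ge_2 by (simp add: elt_rank_def)
  qed
qed

text \<open>Every element of \<open>H_j\<close> is below a facet of \<open>H_j\<close>, and
  \<open>H_j\<close> is closed downward; hence avoiding these facets means lying outside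
  \<open>H_j\<close>.\<close>

lemma shelling_partition:
  fixes P :: "'a::order set"
  assumes "finite P" "distinct xs" "set xs = facets P"
  shows "(\<Sum>x\<in>P. f x) = (\<Sum>j<length xs. \<Sum>z | z \<in> P \<and> z \<le> xs ! j \<and>
     (\<forall>a\<in>facets (shelling_H P xs j). \<not> z \<le> a). (f z :: 'b::comm_monoid_add))"
proof -
  \<comment> \<open>\<open>D j\<close> collects the elements for which \<open>xs ! j\<close> is the
    first facet above them.\<close>
  define D where "D j = pideal P (xs ! j) - (\<Union>i<j. pideal P (xs ! i))" for j
  have D: "{z. z \<in> P \<and> z \<le> xs ! j \<and> (\<forall>a\<in>facets (shelling_H P xs j). \<not> z \<le> a)} = D j"
    for j
  proof (intro equalityI subsetI)
    fix z assume z: "z \<in> {z. z \<in> P \<and> z \<le> xs ! j \<and> (\<forall>a\<in>facets (shelling_H P xs j). \<not> z \<le> a)}"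
    have "z \<notin> shelling_H P xs j"
      using exists_facet_ge[of "shelling_H P xs j" z] z assms(1)
      by (auto simp: shelling_H_def finite_pideal)
    then show "z \<in> D j" using z by (auto simp: D_def shelling_H_def pideal_def)
  next
    fix z assume z: "z \<in> D j"
    have False if "a \<in> facets (shelling_H P xs j)" "z \<le> a" for a
    proof -
      from that(1) have "a \<in> (\<Union>i<j. pideal P (xs ! i))" by (simp add: facets_def shelling_H_def)
      then have "z \<in> (\<Union>i<j. pideal P (xs ! i))"
        using that(2) z by (auto simp: D_def pideal_def intro: order_trans)
      then show False using z by (simp add: D_def)
    qed
    then show "z \<in> {z. z \<in> P \<and> z \<le> xs ! j \<and> (\<forall>a\<in>facets (shelling_H P xs j). \<not> z \<le> a)}"
      using z by (auto simp: D_def pideal_def)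
  qed
  have "P = (\<Union>j<length xs. D j)"
  proof (intro equalityI subsetI)
    fix z assume z: "z \<in> P"
    let ?Q = "\<lambda>j. j < length xs \<and> z \<in> pideal P (xs ! j)"
    obtain y where "y \<in> facets P" "z \<le> y" using exists_facet_ge[OF assms(1) z] by auto
    then have ex: "\<exists>j. ?Q j" using z assms(3)[symmetric] by (auto simp: in_set_conv_nth pideal_def)
    have "?Q (LEAST j. ?Q j)" using ex by (rule LeastI_ex)
    moreover have "z \<notin> pideal P (xs ! i)" if "i < (LEAST j. ?Q j)" for i
      using not_less_Least[OF that] that calculation by simp
    ultimately show "z \<in> (\<Union>j<length xs. D j)" unfolding D_def by blast
  qed (auto simp: D_def pideal_def)
  moreover have "D i \<inter> D j = {}" if "i \<noteq> j" for i j
    using that by (cases i j rule: linorder_cases) (auto simp: D_def)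
  ultimately have "(\<Sum>x\<in>P. f x) = (\<Sum>j<length xs. \<Sum>z\<in>D j. f z)"
    using assms(1) by (subst sum.UNION_disjoint[symmetric]) (auto simp: D_def finite_pideal)
  then show ?thesis by (simp only: D)
qed

text \<open>By purity all facets have the same rank, so the pieces of the partition expand in the
  same polynomials and their coefficients add up.\<close>

lemma C_shellable_rank_sum_positive:
  fixes P :: "'a::order set"
  assumes "q_poset TYPE('k::{field,finite}) P" "C_shellable P"
  shows "\<exists>h. (\<forall>k. 0 \<le> h k) \<and> (\<Sum>x\<in>P. monom 1 (elt_rank P x)) =
    (\<Sum>k\<le>poset_rank P. smult (h k) (R_poly CARD('k) (poset_rank P) k))"
proof -
  let ?R = "R_poly CARD('k) (poset_rank P)"
  obtain xs where xs: "C_shelling P xs" using assms(2) by (auto simp: C_shellable_def)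
  note P = C_shelling_facts[OF xs]
  define S where "S j = (\<Sum>z | z \<in> P \<and> z \<le> xs ! j \<and>
     (\<forall>a\<in>facets (shelling_H P xs j). \<not> z \<le> a). monom (1::real) (elt_rank P z))" for j
  have "\<exists>h. (\<forall>k. 0 \<le> h k) \<and> S j = (\<Sum>k\<le>poset_rank P. smult (h k) (?R k))"
    if j: "j < length xs" for j
  proof -
    have xj: "xs ! j \<in> facets P" using nth_mem[OF j] P(4) by simp
    then have rank: "elt_rank P (xs ! j) = poset_rank P" by (rule elt_rank_facet[OF P(1,2)])
    have "xs ! j \<in> P" using xj by (simp add: facets_def)
    moreover have "a \<in> P \<and> a \<le> xs ! j \<and> Suc (elt_rank P a) = elt_rank P (xs ! j)"
      if a: "a \<in> facets (shelling_H P xs j)" for a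
    proof -
      have "0 < j" using a by (cases j) (auto simp: shelling_H_def facets_def)
      then show ?thesis using shelling_H_facet_rank[OF xs j _ a] by blast
    qed
    ultimately show ?thesis
      unfolding rank[symmetric] S_def by (intro avoiding_rank_sum_positive[OF assms(1)])
  qed
  then have "\<forall>j. \<exists>h. j < length xs \<longrightarrow>
      (\<forall>k. 0 \<le> h k) \<and> S j = (\<Sum>k\<le>poset_rank P. smult (h k) (?R k))"
    by blast
  from choice[OF this] obtain h where h: "\<And>j k. j < length xs \<Longrightarrow> 0 \<le> h j k"
    "\<And>j. j < length xs \<Longrightarrow> S j = (\<Sum>k\<le>poset_rank P. smult (h j k) (?R k))"
    by blast
  have "(\<Sum>x\<in>P. monom (1::real) (elt_rank P x)) = (\<Sum>j<length xs. S j)"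
    unfolding S_def by (rule shelling_partition[OF P(1,3,4)])
  also have "\<dots> = (\<Sum>k\<le>poset_rank P. smult (\<Sum>j<length xs. h j k) (?R k))"
    using h(2) by (simp add: smult_sum) (rule sum.swap)
  finally have "(\<Sum>x\<in>P. monom 1 (elt_rank P x)) =
      (\<Sum>k\<le>poset_rank P. smult (\<Sum>j<length xs. h j k) (?R k))" .
  moreover have "0 \<le> (\<Sum>j<length xs. h j k)" for k
    using h(1) by (intro sum_nonneg) simp
  ultimately show ?thesis
    by (intro exI[of _ "\<lambda>k. \<Sum>j<length xs. h j k"] conjI allI)
qed

lemma q_poset_rank_eq:
  fixes P :: "'a::order set"
  assumes "q_poset TYPE('k::{field,finite}) P" "pure_poset P"
  shows "q_poset_rank TYPE('k) P = poset_rank P"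
proof -
  have fin: "finite P" and "P \<noteq> {}" using assms(1) by (auto simp: q_poset_def has_least_def)
  then obtain y where y: "y \<in> facets P" using exists_facet_ge by blast
  have img: "q_rank TYPE('k) P ` P = elt_rank P ` P" using q_rank_eq[OF assms(1)] by simp
  show ?thesis
    unfolding q_poset_rank_def img
  proof (rule Max_eqI)
    show "poset_rank P \<in> elt_rank P ` P"
      using y elt_rank_facet[OF fin assms(2) y] by (force simp: facets_def)
    fix d assume "d \<in> elt_rank P ` P"
    then obtain x where x: "x \<in> P" "d = elt_rank P x" by auto
    obtain z where z: "z \<in> facets P" "x \<le> z" using exists_facet_ge[OF fin x(1)] by blast
    then show "d \<le> poset_rank P"
      using elt_rank_mono[OF fin x(1), of z] elt_rank_facet[OF fin assms(2) z(1)] x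
      by (simp add: facets_def)
  qed (use fin in simp)
qed

section \<open>Chain polynomials\<close>

definition chain_val :: "complex \<Rightarrow> 'a::order set \<Rightarrow> complex" where
  "chain_val z Q = (\<Sum>C | pred_on.chain Q (\<le>) C. z ^ card C)"

lemma poly_map_poly_of_real: "poly (map_poly complex_of_real p) z = lin_ext (\<lambda>i. z ^ i) p"
  by (simp add: poly_altdef lin_ext_def degree_map_poly coeff_map_poly scaleR_conv_of_real)

lemma poly_chain_poly: "poly (map_poly complex_of_real (chain_poly Q)) z = chain_val z Q"
  unfolding poly_map_poly_of_real chain_poly_def chain_val_def
  by (simp add: lin_ext_sum lin_ext_monom)

lemma finite_chain_has_greatest:
  fixes C :: "'a::order set"
  assumes "finite C" "C \<noteq> {}" "\<forall>x\<in>C. \<forall>y\<in>C. x \<le> y \<or> y \<le> x"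
  shows "\<exists>m\<in>C. \<forall>y\<in>C. y \<le> m"
proof -
  obtain m where m: "m \<in> C" "\<And>y. y \<in> C \<Longrightarrow> m \<le> y \<Longrightarrow> m = y"
    using finite_has_maximal[OF assms(1,2)] by blast
  then have "\<forall>y\<in>C. y \<le> m" using assms(3) by (metis order_refl)
  then show ?thesis using m(1) by blast
qed

lemma chains_eq_Union:
  fixes Q :: "'a::order set"
  assumes "finite Q"
  shows "{C. pred_on.chain Q (\<le>) C} =
    insert {} (\<Union>x\<in>Q. insert x ` {D. pred_on.chain {y\<in>Q. y < x} (\<le>) D})" (is "?L = ?R")
proof (intro equalityI subsetI)
  fix C assume "C \<in> ?L"
  then have C: "C \<subseteq> Q" "\<forall>x\<in>C. \<forall>y\<in>C. x \<le> y \<or> y \<le> x" by (simp_all add: chain_iff)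
  show "C \<in> ?R"
  proof (cases "C = {}")
    case False
    obtain m where m: "m \<in> C" "\<forall>y\<in>C. y \<le> m"
      using finite_chain_has_greatest[OF finite_subset[OF C(1) assms] False C(2)] by blast
    have "pred_on.chain {y\<in>Q. y < m} (\<le>) (C - {m})"
      using C m(2) unfolding chain_iff by (auto simp: less_le)
    moreover have "C = insert m (C - {m})" "m \<in> Q" using m(1) C(1) by auto
    ultimately show ?thesis by blast
  qed simp
next
  fix C assume "C \<in> ?R"
  then consider "C = {}" | x D where "x \<in> Q" "pred_on.chain {y\<in>Q. y < x} (\<le>) D" "C = insert x D"
    by blast
  then show "C \<in> ?L"
  proof cases
    case 2
    then have D: "D \<subseteq> Q" "\<forall>y\<in>D. y < x" "\<forall>x\<in>D. \<forall>y\<in>D. x \<le> y \<or> y \<le> x"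
      unfolding chain_iff by blast+
    then have "\<forall>y\<in>D. y \<le> x" by (simp add: less_imp_le)
    then show ?thesis using D(1,3) 2(1,3) by (simp add: chain_iff)
  qed (simp add: chain_iff)
qed

text \<open>The 1 is the empty chain; a nonempty chain is its greatest element \<open>x\<close>,
  accounting for the factor \<open>z\<close>, and a chain below \<open>x\<close>.\<close>

lemma chain_val_rec:
  fixes Q :: "'a::order set"
  assumes "finite Q"
  shows "chain_val z Q = 1 + z * (\<Sum>x\<in>Q. chain_val z {y\<in>Q. y < x})"
proof -
  define F where "F x = insert x ` {D. pred_on.chain {y\<in>Q. y < x} (\<le>) D}" for x
  have D: "D \<subseteq> Q" "\<forall>y\<in>D. y < x" if "pred_on.chain {y\<in>Q. y < x} (\<le>) D" for D x
    using that unfolding chain_iff by blast+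
  have finF: "finite (F x)" for x
    unfolding F_def using finite_chains[of "{y\<in>Q. y < x}"] assms by simp
  have disj: "F x \<inter> F y = {}" if "x \<noteq> y" for x y
  proof (rule ccontr)
    assume "F x \<inter> F y \<noteq> {}"
    then obtain D E where DE: "pred_on.chain {w\<in>Q. w < x} (\<le>) D" "pred_on.chain {w\<in>Q. w < y} (\<le>) E"
        "insert x D = insert y E"
      unfolding F_def by blast
    then have "x \<in> E" "y \<in> D" using that by auto
    then have "x < y" "y < x" using D(2)[OF DE(1)] D(2)[OF DE(2)] by auto
    then show False by simp
  qed
  have sumF: "(\<Sum>C\<in>F x. z ^ card C) = z * chain_val z {y\<in>Q. y < x}" for x
  proof -
    have notin: "x \<notin> D" "finite D" if "pred_on.chain {y\<in>Q. y < x} (\<le>) D" for D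
      using D[OF that] assms finite_subset by auto
    have "inj_on (insert x) {D. pred_on.chain {y\<in>Q. y < x} (\<le>) D}"
    proof (rule inj_onI)
      fix D E assume "D \<in> {D. pred_on.chain {y\<in>Q. y < x} (\<le>) D}"
        "E \<in> {D. pred_on.chain {y\<in>Q. y < x} (\<le>) D}" "insert x D = insert x E"
      then show "D = E" using notin(1)[of D] notin(1)[of E] by (simp add: insert_ident)
    qed
    then have "(\<Sum>C\<in>F x. z ^ card C) =
        (\<Sum>D | pred_on.chain {y\<in>Q. y < x} (\<le>) D. z ^ card (insert x D))"
      unfolding F_def by (simp add: sum.reindex)
    also have "\<dots> = (\<Sum>D | pred_on.chain {y\<in>Q. y < x} (\<le>) D. z * z ^ card D)"
      using notin by (intro sum.cong) simp_all
    finally show ?thesis by (simp add: chain_val_def sum_distrib_left)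
  qed
  have "{} \<notin> (\<Union>x\<in>Q. F x)" by (auto simp: F_def)
  moreover have "finite (\<Union>x\<in>Q. F x)" using assms finF by simp
  ultimately have "chain_val z Q = 1 + (\<Sum>C\<in>(\<Union>x\<in>Q. F x). z ^ card C)"
    unfolding chain_val_def chains_eq_Union[OF assms] F_def[symmetric] by simp
  also have "(\<Sum>C\<in>(\<Union>x\<in>Q. F x). z ^ card C) = (\<Sum>x\<in>Q. \<Sum>C\<in>F x. z ^ card C)"
    using assms finF disj by (intro sum.UNION_disjoint) auto
  finally show ?thesis by (simp add: sumF sum_distrib_left)
qed

text \<open>The value at \<open>z\<close> of the chain polynomial of the selected elements strictly
  below an element of rank \<open>m\<close>, as \<open>chain_val_below\<close> shows. The
  coefficient of \<open>R_{m,0}\<close> at \<open>t^j\<close> counts the elements of rank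
  \<open>j\<close> in its ideal.\<close>

fun below_val :: "nat \<Rightarrow> complex \<Rightarrow> nat set \<Rightarrow> nat \<Rightarrow> complex" where
  "below_val q z S m = 1 + z * (\<Sum>j<m. if j \<in> S then coeff (R_poly q m 0) j *\<^sub>R below_val q z S j else 0)"

declare below_val.simps [simp del]

text \<open>The contribution of one element of rank \<open>m\<close> to
  \<open>chain_val_rec\<close>, with the leading 1 charged to the least element. This makes the
  chain value linear in the rank generating polynomial.\<close>

definition rank_weight :: "nat \<Rightarrow> complex \<Rightarrow> nat set \<Rightarrow> nat \<Rightarrow> complex" where
  "rank_weight q z S m = (if m = 0 then 1 else 0) + (if m \<in> S then z * below_val q z S m else 0)"

text \<open>\<open>R_{n+1,0} - t^(n+1)\<close> is the rank generating polynomial of the part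
  strictly below an element of rank \<open>n + 1\<close>, and \<open>R_poly_eq_sum\<close> rewrites
  it at level \<open>n\<close>.\<close>

lemma below_val_Suc:
  "below_val q z S (Suc n) =
    (\<Sum>i=0..n. real q ^ i *\<^sub>R lin_ext (rank_weight q z S) (R_poly q n i))"
proof -
  let ?e = "rank_weight q z S" and ?R = "R_poly q (Suc n) 0"
  have "(\<Sum>i=0..n. real q ^ i *\<^sub>R lin_ext ?e (R_poly q n i)) = lin_ext ?e (?R - monom 1 (Suc n))"
    by (simp add: R_poly_eq_sum[of 0] lin_ext_sum lin_ext_smult)
  also have "\<dots> = (\<Sum>j\<le>Suc n. coeff ?R j *\<^sub>R ?e j) - ?e (Suc n)"
    by (simp add: lin_ext_diff lin_ext_monom lin_ext_degree_le[OF degree_R_poly])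
  also have "\<dots> = (\<Sum>j\<le>n. coeff ?R j *\<^sub>R ?e j)"
    by (simp add: coeff_R_poly_top)
  also have "\<dots> = (\<Sum>j\<le>n. (if j = 0 then 1 else 0) +
      z * (if j \<in> S then coeff ?R j *\<^sub>R below_val q z S j else 0))"
    by (intro sum.cong) (auto simp: rank_weight_def coeff_R_poly_0 algebra_simps)
  also have "\<dots> = 1 + z * (\<Sum>j<Suc n. if j \<in> S then coeff ?R j *\<^sub>R below_val q z S j else 0)"
    by (simp add: sum.distrib sum_distrib_left lessThan_Suc_atMost del: sum.lessThan_Suc)
  also have "\<dots> = below_val q z S (Suc n)"
    by (rule below_val.simps[symmetric])
  finally show ?thesis ..
qed

lemma Im_mobius_pos:
  assumes "Im z > 0"
  shows "Im (z / (1 + z)) > 0"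
proof -
  have "Im (z / (1 + z)) = Im z / ((1 + Re z)\<^sup>2 + (Im z)\<^sup>2)"
    by (simp add: Im_divide algebra_simps)
  moreover have "(1 + Re z)\<^sup>2 + (Im z)\<^sup>2 > 0" using assms by (simp add: add_nonneg_pos)
  ultimately show ?thesis using assms by simp
qed

text \<open>
  Substituting \<open>u = z / (1 + z)\<close>, which maps the upper half-plane into itself, turns the step
  from \<open>n\<close> to \<open>n + 1\<close> into one of the two operations of \<open>fan_tails\<close>.
\<close>
lemma fan_R_poly:
  fixes q :: nat
    and S :: "nat set"
  assumes "Im z > 0" "q > 0"
  defines "w \<equiv> \<lambda>n k. lin_ext (rank_weight q z S) (R_poly q n k)"
  shows "fan (z / (1 + z)) n (w n) \<and> w n 0 \<noteq> 0"
proof (induction n)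
  case 0
  have "below_val q z S 0 = 1" by (simp add: below_val.simps)
  then have w0: "w 0 0 = (if 0 \<in> S then 1 + z else 1)"
    by (simp add: w_def R_poly_self lin_ext_monom rank_weight_def del: monom_0 monom_eq_1)
  have "Im (u * w 0 0 * cnj (w 0 0)) = Im u * (cmod (w 0 0))\<^sup>2" for u
    unfolding mult.assoc complex_norm_square[symmetric] by simp
  from this[of 1] this have "fan u 0 (w 0)" if "Im u > 0" for u
    using that unfolding fan_def by (simp del: times_complex.sel)
  from this[OF Im_mobius_pos[OF assms(1)]] have "fan (z / (1 + z)) 0 (w 0)" .
  moreover have "w 0 0 \<noteq> 0" using assms(1) w0 by (auto simp: complex_eq_iff)
  ultimately show ?case by blast
next
  case (Suc n)
  let ?u = "z / (1 + z)"
  have z1: "1 + z \<noteq> 0" using assms(1) by (auto simp: complex_eq_iff)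
  define g where "g = (\<lambda>i. real q ^ i *\<^sub>R w n i)"
  have fan_g: "fan ?u n g" unfolding g_def using Suc by (intro fan_scaleR) auto
  \<comment> \<open>This sum is, up to a nonzero factor, the next value at index 0.\<close>
  have "(\<Sum>k\<le>n. g k) \<noteq> 0"
    unfolding g_def using Suc Im_mobius_pos[OF assms(1)] assms(2)
    by (intro fan_combination_nonzero[where u = "z / (1 + z)"]) simp_all
  then have nz: "(\<Sum>i=0..n. g i) \<noteq> 0" by (simp add: atMost_atLeast0)
  \<comment> \<open>\<open>R_{n+1,n+1} = t^(n+1)\<close> is sent to the weight of rank
    \<open>n + 1\<close>, which \<open>below_val_Suc\<close> expresses by the full sum of
    \<open>g\<close>.\<close>
  have top: "w (Suc n) (Suc n) = (if Suc n \<in> S then z * (\<Sum>i=0..n. g i) else 0)"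
    by (simp add: w_def g_def R_poly_self lin_ext_monom rank_weight_def below_val_Suc)
  have step: "w (Suc n) k = w (Suc n) (Suc n) + (\<Sum>i=k..n. g i)" if "k \<le> Suc n" for k
    using that by (simp add: w_def g_def R_poly_eq_sum[of k] R_poly_self lin_ext_add lin_ext_sum lin_ext_smult)
  have cong: "fan ?u (Suc n) (w (Suc n))" if "fan ?u (Suc n) v" "\<And>k. k \<le> Suc n \<Longrightarrow> w (Suc n) k = v k" for v
    unfolding fan_def
  proof (intro allI impI)
    fix k l assume kl: "k \<le> l \<and> l \<le> Suc n"
    then have "w (Suc n) k = v k" "w (Suc n) l = v l" using that(2) by simp_all
    then show "0 \<le> Im (w (Suc n) l * cnj (w (Suc n) k)) \<and>
        0 \<le> Im (?u * w (Suc n) k * cnj (w (Suc n) l))"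
      using that(1) kl unfolding fan_def by simp
  qed
  show ?case
  proof (cases "Suc n \<in> S")
    case False
    then have "w (Suc n) k = (\<Sum>i=k..n. g i)" if "k \<le> Suc n" for k using step[OF that] top by simp
    then show ?thesis
      using cong[OF fan_tails(1)[OF fan_g Im_mobius_pos[OF assms(1)]]] nz by simp
  next
    case True
    have eq: "w (Suc n) k = (1 + z) * (?u * (\<Sum>i<k. g i) + (\<Sum>i=k..n. g i))" if "k \<le> Suc n" for k
    proof -
      have "{0..n} = {..<k} \<union> {k..n}" using that by auto
      then have "(\<Sum>i=0..n. g i) = (\<Sum>i<k. g i) + (\<Sum>i=k..n. g i)"
        by (simp add: sum.union_disjoint ivl_disj_int)
      then have "w (Suc n) k = z * (\<Sum>i<k. g i) + (1 + z) * (\<Sum>i=k..n. g i)"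
        using step[OF that] top True by (simp add: algebra_simps)
      also have "\<dots> = (1 + z) * (?u * (\<Sum>i<k. g i) + (\<Sum>i=k..n. g i))"
        using z1 by (simp add: distrib_left)
      finally show ?thesis .
    qed
    have "fan ?u (Suc n) (w (Suc n))"
      by (rule cong[OF fan_mult[OF fan_tails(2)[OF fan_g Im_mobius_pos[OF assms(1)]]] eq])
    moreover have "w (Suc n) 0 \<noteq> 0" using eq[of 0] z1 nz by simp
    ultimately show ?thesis by blast
  qed
qed

text \<open>By \<open>rank_sum_pideal\<close> the number of elements of each rank below
  \<open>x\<close> depends only on the rank of \<open>x\<close>; induction on that rank transfers
  this to the chain value.\<close>

lemma chain_val_below:
  fixes P :: "'a::order set"
  assumes "q_poset TYPE('k::{field,finite}) P" "x \<in> P"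
  shows "chain_val z {y\<in>P. elt_rank P y \<in> S \<and> y < x} = below_val CARD('k) z S (elt_rank P x)"
  using assms(2)
proof (induction "elt_rank P x" arbitrary: x rule: less_induct)
  case less
  let ?m = "elt_rank P x" and ?B = "below_val CARD('k) z S"
  let ?Q = "{y\<in>P. elt_rank P y \<in> S \<and> y < x}"
  have fin: "finite P" using assms(1) unfolding q_poset_def by (rule conjunct1)
  \<comment> \<open>The value 0 at rank \<open>?m\<close> removes \<open>x\<close> itself from the
    sum over its ideal.\<close>
  define e where "e j = (if j < ?m \<and> j \<in> S then ?B j else 0)" for j
  have "chain_val z {w\<in>?Q. w < y} = ?B (elt_rank P y)" if y: "y \<in> ?Q" for y
  proof -
    have "{w\<in>?Q. w < y} = {w\<in>P. elt_rank P w \<in> S \<and> w < y}" using y by (auto intro: less_trans)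
    then show ?thesis using less.hyps[of y] y elt_rank_less[OF fin _ less.prems] by simp
  qed
  then have "chain_val z ?Q = 1 + z * (\<Sum>y\<in>?Q. ?B (elt_rank P y))"
    using fin by (subst chain_val_rec) simp_all
  also have "(\<Sum>y\<in>?Q. ?B (elt_rank P y)) = (\<Sum>y\<in>pideal P x. e (elt_rank P y))"
  proof (rule sum.mono_neutral_cong_left)
    show "finite (pideal P x)" using fin by (rule finite_pideal)
    show "?Q \<subseteq> pideal P x" by (auto simp: pideal_def)
    show "\<forall>y\<in>pideal P x - ?Q. e (elt_rank P y) = 0"
      by (auto simp: pideal_def e_def le_less)
    show "?B (elt_rank P y) = e (elt_rank P y)" if "y \<in> ?Q" for y
      using that elt_rank_less[OF fin _ less.prems] by (simp add: e_def)
  qed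
  also have "\<dots> = lin_ext e (\<Sum>y\<in>pideal P x. monom 1 (elt_rank P y))"
    by (simp add: lin_ext_sum lin_ext_monom)
  also have "\<dots> = lin_ext e (R_poly CARD('k) ?m 0)"
    by (simp only: rank_sum_pideal[OF assms(1) less.prems])
  also have "\<dots> = (\<Sum>j<?m. if j \<in> S then coeff (R_poly CARD('k) ?m 0) j *\<^sub>R ?B j else 0)"
    unfolding lin_ext_degree_le[OF degree_R_poly[OF le0]]
    by (intro sum.mono_neutral_cong_right) (auto simp: e_def)
  finally show ?case by (simp add: below_val.simps[of _ _ _ ?m])
qed

lemma elt_rank_eq_0_iff:
  fixes P :: "'a::order set"
  assumes "finite P" "b \<in> P" "\<forall>x\<in>P. b \<le> x" "x \<in> P"
  shows "elt_rank P x = 0 \<longleftrightarrow> x = b"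
proof
  have "pideal P b = {b}" using assms(2,3) by (auto simp: pideal_def intro: antisym)
  moreover have "poset_rank {b} = 0"
  proof (rule poset_rank_eqI[where C = "{b}"])
    show "card C \<le> Suc 0" if "pred_on.chain {b} (\<le>) C" for C
      using that card_mono[of "{b}" C] by (simp add: chain_iff)
  qed (auto simp: chain_iff)
  ultimately show "elt_rank P x = 0" if "x = b" using that by (simp add: elt_rank_def)
  show "x = b" if "elt_rank P x = 0"
  proof (rule ccontr)
    assume "x \<noteq> b"
    then have "b < x" using assms(3,4) by (simp add: less_le)
    then show False using elt_rank_less[OF assms(1,2,4)] that by simp
  qed
qed

lemma sum_elt_rank_0:
  fixes P :: "'a::order set"
  assumes "finite P" "has_least P"
  shows "(\<Sum>x\<in>P. if elt_rank P x = 0 then 1 else 0) = (1 :: 'b::semiring_1)"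
proof -
  obtain b where b: "b \<in> P" "\<forall>x\<in>P. b \<le> x" using assms(2) unfolding has_least_def by blast
  have "(\<Sum>x\<in>P. if elt_rank P x = 0 then 1 else 0) = (\<Sum>x\<in>P. if x = b then 1 else (0 :: 'b))"
    using elt_rank_eq_0_iff[OF assms(1) b] by (intro sum.cong) auto
  then show ?thesis using b assms(1) by simp
qed

lemma chain_val_rank_selected:
  fixes P :: "'a::order set"
  assumes "q_poset TYPE('k::{field,finite}) P"
  shows "chain_val z {x\<in>P. elt_rank P x \<in> S} =
    lin_ext (rank_weight CARD('k) z S) (\<Sum>x\<in>P. monom 1 (elt_rank P x))"
    and "coeff (\<Sum>x\<in>P. monom (1::real) (elt_rank P x)) 0 = 1"
proof -
  let ?B = "below_val CARD('k) z S" and ?Q = "{x\<in>P. elt_rank P x \<in> S}"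
  have b: "finite P" "has_least P" using assms unfolding q_poset_def by blast+
  have "{y\<in>?Q. y < x} = {y\<in>P. elt_rank P y \<in> S \<and> y < x}" for x by blast
  then have "chain_val z ?Q = 1 + z * (\<Sum>x\<in>?Q. ?B (elt_rank P x))"
    using b(1) chain_val_below[OF assms] by (subst chain_val_rec) simp_all
  \<comment> \<open>Exactly one element has rank 0, so the 1 can be spread over
    \<open>P\<close>.\<close>
  also have "\<dots> = (\<Sum>x\<in>P. (if elt_rank P x = 0 then 1 else 0) +
      z * (if elt_rank P x \<in> S then ?B (elt_rank P x) else 0))"
    by (simp only: sum.inter_filter[OF b(1)] sum.distrib sum_elt_rank_0[OF b] sum_distrib_left)
  also have "\<dots> = (\<Sum>x\<in>P. rank_weight CARD('k) z S (elt_rank P x))"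
    by (intro sum.cong) (auto simp: rank_weight_def)
  finally show "chain_val z ?Q =
      lin_ext (rank_weight CARD('k) z S) (\<Sum>x\<in>P. monom 1 (elt_rank P x))"
    by (simp add: lin_ext_sum lin_ext_monom)
  have "coeff (\<Sum>x\<in>P. monom (1::real) (elt_rank P x)) 0 = (\<Sum>x\<in>P. if elt_rank P x = 0 then 1 else 0)"
    by (simp add: coeff_sum)
  then show "coeff (\<Sum>x\<in>P. monom (1::real) (elt_rank P x)) 0 = 1"
    using sum_elt_rank_0[OF b, where 'b = real] by simp
qed

section \<open>From nonvanishing in the upper half-plane to real-rootedness\<close>

lemma real_rootedI:
  assumes "\<And>z. Im z > 0 \<Longrightarrow> poly (map_poly complex_of_real p) z \<noteq> 0"
  shows "real_rooted p"
  unfolding real_rooted_def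
proof (intro allI impI)
  fix z assume z: "poly (map_poly complex_of_real p) z = 0"
  have "poly (map_poly complex_of_real p) (cnj z) = cnj (poly (map_poly complex_of_real p) z)"
    by (simp add: poly_map_poly_of_real lin_ext_def)
  then have "\<not> Im z > 0" "\<not> Im (cnj z) > 0" using assms[of z] assms[of "cnj z"] z by auto
  then show "z \<in> \<real>" by (simp add: complex_is_Real_iff)
qed

lemma real_rooted_rank_selected:
  fixes P :: "'a::order set"
  assumes "q_poset TYPE('k::{field,finite}) P" "\<And>k. 0 \<le> h k"
    "(\<Sum>x\<in>P. monom 1 (elt_rank P x)) = (\<Sum>k\<le>n. smult (h k) (R_poly CARD('k) n k))"
  shows "real_rooted (chain_poly {x\<in>P. elt_rank P x \<in> S})"
proof (rule real_rootedI)
  fix z :: complex assume z: "Im z > 0"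
  let ?w = "\<lambda>k. lin_ext (rank_weight CARD('k) z S) (R_poly CARD('k) n k)"
  \<comment> \<open>Comparing constant terms gives \<open>h 0 = 1\<close>, the positive coefficient
    that \<open>fan_combination_nonzero\<close> asks for.\<close>
  have "h 0 = (\<Sum>k\<le>n. if k = 0 then h k else 0)" by simp
  also have "\<dots> = coeff (\<Sum>k\<le>n. smult (h k) (R_poly CARD('k) n k)) 0"
    unfolding coeff_sum by (intro sum.cong) (simp_all add: coeff_R_poly_0)
  also have "\<dots> = 1" using chain_val_rank_selected(2)[OF assms(1)] assms(3) by simp
  finally have h0: "h 0 = 1" .
  have "poly (map_poly complex_of_real (chain_poly {x\<in>P. elt_rank P x \<in> S})) z = (\<Sum>k\<le>n. h k *\<^sub>R ?w k)"
    unfolding poly_chain_poly chain_val_rank_selected(1)[OF assms(1)] assms(3)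
    by (simp add: lin_ext_sum lin_ext_smult)
  also have "\<dots> \<noteq> 0"
  proof (rule fan_combination_nonzero)
    have "fan (z / (1 + z)) n ?w \<and> ?w 0 \<noteq> 0" by (rule fan_R_poly[OF z]) simp
    then show "fan (z / (1 + z)) n ?w" "?w 0 \<noteq> 0" by blast+
    show "0 < Im (z / (1 + z))" by (rule Im_mobius_pos[OF z])
  qed (simp_all add: assms(2) h0)
  finally show "poly (map_poly complex_of_real (chain_poly {x\<in>P. elt_rank P x \<in> S})) z \<noteq> 0" .
qed

theorem theorem7p11:
  fixes q :: nat and P :: "'a::order set"
  assumes "primepow q" and "CARD('k::{field,finite}) = q"
    and "q_poset TYPE('k) P" and "C_shellable P"
  shows "Bq_positive TYPE('k) P \<and>
    real_rooted (chain_poly P) \<and>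
    (\<forall>S :: nat set. real_rooted (chain_poly (rank_selected TYPE('k) P S)))"
proof (intro conjI allI)
  obtain h where h: "\<And>k. 0 \<le> h k" "(\<Sum>x\<in>P. monom 1 (elt_rank P x)) =
      (\<Sum>k\<le>poset_rank P. smult (h k) (R_poly CARD('k) (poset_rank P) k))"
    using C_shellable_rank_sum_positive[OF assms(3,4)] by blast
  have "pure_poset P" using assms(4) unfolding C_shellable_def by (rule conjunct1)
  then have n: "q_poset_rank TYPE('k) P = poset_rank P" by (rule q_poset_rank_eq[OF assms(3)])
  have "rank_gen_poly TYPE('k) P = (\<Sum>x\<in>P. monom 1 (elt_rank P x))"
    unfolding rank_gen_poly_def by (intro sum.cong) (simp_all add: q_rank_eq[OF assms(3)])
  then show "Bq_positive TYPE('k) P"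
    unfolding Bq_positive_def n h(2) using h(1) by (intro exI[of _ h]) simp
  note rr = real_rooted_rank_selected[OF assms(3) h]
  \<comment> \<open>Selecting all ranks gives \<open>P\<close> itself.\<close>
  show "real_rooted (chain_poly P)" using rr[of UNIV] by simp
  show "real_rooted (chain_poly (rank_selected TYPE('k) P S))" for S
  proof -
    have "rank_selected TYPE('k) P S = {x\<in>P. elt_rank P x \<in> S}"
      unfolding rank_selected_def by (auto simp: q_rank_eq[OF assms(3)])
    then show ?thesis using rr[of S] by simp
  qed
qed

end
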